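(* For any $\delta\in\left(0,(\beta_0-\alpha_0)/2\right)$ and $r\in\mathcal R_\delta=[\alpha_0+\delta,\beta_0-\delta]$, there exists $\varepsilon_\delta>0$ such that, if $\varepsilon\in(0,\varepsilon_\delta)$, then the energy $E^0_{\varepsilon r}=E_\varepsilon[z_{\varepsilon r}]$ of the Maxwell solution is strictly less than the energy $E_\varepsilon[z]$ of any other simple solution $z$ (if any) of the problem $$Q''(\varepsilon z')z''=F'(z)-\sigma\ \text{ in }(-\varepsilon^{-1},\varepsilon^{-1}),\qquad z'(\pm\varepsilon^{-1})=0,\qquad \int_{-\varepsilon^{-1}}^{\varepsilon^{-1}}z(x)\,dx=2r\varepsilon^{-1}$$ (with unknowns the positive function $z$ and the constant $\sigma\in\mathbb R$).
   Context: $Q(s)=\sqrt{1+s^2}-1$. Fix $0<\overline\alpha<\underline\beta$ and $F\in C^5(0,\infty)$ (real valued) with $F''>0$ on $(0,\overline\alpha)\cup(\underline\beta,\infty)$, $F''<0$ on $(\overline\alpha,\underline\beta)$, $F'(0)<F'(\underline\beta)$ and $F'(\infty)>F'(\overline\alpha)$, where $F'(0),F'(\infty)$ denote the limits of $F'$ at $0^+$ and $+\infty$. Put $\underline\sigma:=F'(\underline\beta)$, $\overline\sigma:=F'(\overline\alpha)$ and, for $\sigma\in[\underline\sigma,\overline\sigma]$, let $\Phi_\sigma(z):=F(z)-\sigma z$. Its critical points are $\alpha_\sigma\le\zeta_\sigma\le\beta_\sigma$, the solutions of $F'(\cdot)=\sigma$ in $(0,\overline\alpha]$, $[\overline\alpha,\underline\beta]$,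 $[\underline\beta,\infty)$ respectively. The value $\sigma_0\in(\underline\sigma,\overline\sigma)$ is the unique one for which $\Phi_{\sigma_0}(\alpha_{\sigma_0})=\Phi_{\sigma_0}(\beta_{\sigma_0})$; write $\alpha_0=\alpha_{\sigma_0}$, $\beta_0=\beta_{\sigma_0}$, $b_0=\Phi_{\sigma_0}(\alpha_0)=\Phi_{\sigma_0}(\beta_0)$, $\Delta_0=(\sigma_0,b_0)$ (Maxwell point). A pair $\Delta=(\sigma,b)$ is admissible if $\sigma\in(\underline\sigma,\overline\sigma)$ and $\max\{\Phi_\sigma(\alpha_\sigma),\Phi_\sigma(\beta_\sigma)\}<b<\Phi_\sigma(\zeta_\sigma)$. A simple solution of the problem in the claim is a (non-constant) increasing solution; it satisfies $P_\varepsilon(z')=\Phi_\sigma(z)-b$ for a constant $b$, with $P_\varepsilon(s)=\varepsilon^{-2}\bigl(1-\tfrac{1}{\sqrt{1+\varepsilon^2s^2}}\bigr)$, and its corresponding admissible pair is $\Delta=(\sigma,b)$. Maxwell solution: for every $\delta\in(0,(\beta_0-\alpha_0)/2)$ there exist $\varepsilon_\delta>0$ and a neighborhood $\mathcal N_\delta$ of $\Delta_0$ such that for $\varepsilon\in(0,\varepsilon_\delta)$ and $r\in\mathcal R_\delta$ there is exactly one simple solution whose admissible pair $\Delta(\varepsilon,r)$ lies in $\mathcal N_\delta$, and $\Delta(\varepsilon,r)=\Delta_0+O(\exp(-C/\varepsilon))$ as $\varepsilon\to0^+$ uniformly in $r\in\mathcal R_\delta$, for some $C=C_\delta>0$. This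 solution is the Maxwell solution $z_{\varepsilon r}$. The energy is $E_\varepsilon[z]=\varepsilon\int_{-\varepsilon^{-1}}^{\varepsilon^{-1}}\left[\frac{Q(\varepsilon z'(t))}{\varepsilon^2}+F(z(t))\right]dt$. *)

theory Defs
  imports "HOL-Analysis.Analysis"
begin

definition C_k_on :: "nat \<Rightarrow> (real \<Rightarrow> real) \<Rightarrow> real set \<Rightarrow> bool" where
  "C_k_on k f S \<longleftrightarrow>
     (\<forall>j<k. \<forall>x\<in>S. (deriv ^^ j) f differentiable (at x)) \<and> continuous_on S ((deriv ^^ k) f)"

definition Q :: "real \<Rightarrow> real" where
  "Q s = sqrt (1 + s\<^sup>2) - 1"

definition P :: "real \<Rightarrow> real \<Rightarrow> real" where
  "P \<epsilon> s = (1 / \<epsilon>\<^sup>2) * (1 - 1 / sqrt (1 + \<epsilon>\<^sup>2 * s\<^sup>2))"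

definition Phi :: "(real \<Rightarrow> real) \<Rightarrow> real \<Rightarrow> real \<Rightarrow> real" where
  "Phi F \<sigma> z = F z - \<sigma> * z"

text \<open>Throughout, \<open>a\<close> and \<open>b\<close> are the two inflection points \<open>0 < a < b\<close> of \<open>F\<close>
  (upper end of the first convexity interval, lower end of the second one).
  The three critical points of \<open>Phi F \<sigma>\<close> below are well defined for
  \<open>deriv F b \<le> \<sigma> \<le> deriv F a\<close>, because \<open>deriv F\<close> is strictly monotone on each
  of the three intervals.\<close>

definition crit_alpha :: "(real \<Rightarrow> real) \<Rightarrow> real \<Rightarrow> real \<Rightarrow> real" where
  "crit_alpha F a \<sigma> = (THE z. z \<in> {0<..a} \<and> deriv F z = \<sigma>)"

definition crit_zeta :: "(real \<Rightarrow> real) \<Rightarrow> real \<Rightarrow> real \<Rightarrow> real \<Rightarrow> real" where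
  "crit_zeta F a b \<sigma> = (THE z. z \<in> {a..b} \<and> deriv F z = \<sigma>)"

definition crit_beta :: "(real \<Rightarrow> real) \<Rightarrow> real \<Rightarrow> real \<Rightarrow> real" where
  "crit_beta F b \<sigma> = (THE z. z \<in> {b..} \<and> deriv F z = \<sigma>)"

definition sigma0 :: "(real \<Rightarrow> real) \<Rightarrow> real \<Rightarrow> real \<Rightarrow> real" where
  "sigma0 F a b = (THE \<sigma>. \<sigma> \<in> {deriv F b<..<deriv F a} \<and>
      Phi F \<sigma> (crit_alpha F a \<sigma>) = Phi F \<sigma> (crit_beta F b \<sigma>))"

definition alpha0 :: "(real \<Rightarrow> real) \<Rightarrow> real \<Rightarrow> real \<Rightarrow> real" where
  "alpha0 F a b = crit_alpha F a (sigma0 F a b)"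

definition beta0 :: "(real \<Rightarrow> real) \<Rightarrow> real \<Rightarrow> real \<Rightarrow> real" where
  "beta0 F a b = crit_beta F b (sigma0 F a b)"

definition maxwell_point :: "(real \<Rightarrow> real) \<Rightarrow> real \<Rightarrow> real \<Rightarrow> real \<times> real" where
  "maxwell_point F a b = (sigma0 F a b, Phi F (sigma0 F a b) (alpha0 F a b))"

definition admissible :: "(real \<Rightarrow> real) \<Rightarrow> real \<Rightarrow> real \<Rightarrow> real \<times> real \<Rightarrow> bool" where
  "admissible F a b \<Delta> \<longleftrightarrow> (case \<Delta> of (\<sigma>, c) \<Rightarrow>
     \<sigma> \<in> {deriv F b<..<deriv F a} \<and>
     max (Phi F \<sigma> (crit_alpha F a \<sigma>)) (Phi F \<sigma> (crit_beta F b \<sigma>)) < c \<and>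
     c < Phi F \<sigma> (crit_zeta F a b \<sigma>))"

definition ival :: "real \<Rightarrow> real set" where
  "ival \<epsilon> = {- (1 / \<epsilon>)..1 / \<epsilon>}"

text \<open>Derivative of \<open>z\<close> on the closed interval, one-sided at the two end points; only
  the values of \<open>z\<close> on \<open>ival \<epsilon>\<close> matter.\<close>

definition dz :: "real \<Rightarrow> (real \<Rightarrow> real) \<Rightarrow> real \<Rightarrow> real" where
  "dz \<epsilon> z t = vector_derivative z (at t within ival \<epsilon>)"

text \<open>Classical solutions: \<open>z\<close> is \<open>C\<^sup>1\<close> up to the boundary and twice differentiable
  inside (the second derivative is then continuous by the equation).\<close>

definition solution ::
    "(real \<Rightarrow> real) \<Rightarrow> real \<Rightarrow> real \<Rightarrow> (real \<Rightarrow> real) \<Rightarrow> real \<Rightarrow> bool" where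
  "solution F \<epsilon> r z \<sigma> \<longleftrightarrow>
     (\<forall>t\<in>ival \<epsilon>. 0 < z t) \<and>
     z differentiable_on ival \<epsilon> \<and> continuous_on (ival \<epsilon>) (dz \<epsilon> z) \<and>
     (\<forall>t\<in>{- (1 / \<epsilon>)<..<1 / \<epsilon>}.
        dz \<epsilon> z differentiable (at t) \<and>
        (deriv ^^ 2) Q (\<epsilon> * dz \<epsilon> z t) * deriv (dz \<epsilon> z) t = deriv F (z t) - \<sigma>) \<and>
     dz \<epsilon> z (- (1 / \<epsilon>)) = 0 \<and> dz \<epsilon> z (1 / \<epsilon>) = 0 \<and>
     integral (ival \<epsilon>) z = 2 * r / \<epsilon>"

definition simple_solution ::
    "(real \<Rightarrow> real) \<Rightarrow> real \<Rightarrow> real \<Rightarrow> (real \<Rightarrow> real) \<Rightarrow> real \<Rightarrow> bool" where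
  "simple_solution F \<epsilon> r z \<sigma> \<longleftrightarrow>
     solution F \<epsilon> r z \<sigma> \<and> mono_on (ival \<epsilon>) z \<and> \<not> z constant_on ival \<epsilon>"

text \<open>\<open>simple_solution_pair F a b \<epsilon> r z \<Delta>\<close>: \<open>z\<close> is a simple solution (with multiplier
  \<open>fst \<Delta>\<close>) and \<open>\<Delta>\<close> is its corresponding admissible pair.\<close>

definition simple_solution_pair ::
    "(real \<Rightarrow> real) \<Rightarrow> real \<Rightarrow> real \<Rightarrow> real \<Rightarrow> real \<Rightarrow> (real \<Rightarrow> real) \<Rightarrow> real \<times> real \<Rightarrow> bool" where
  "simple_solution_pair F a b \<epsilon> r z \<Delta> \<longleftrightarrow>
     simple_solution F \<epsilon> r z (fst \<Delta>) \<and> admissible F a b \<Delta> \<and>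
     (\<forall>t\<in>ival \<epsilon>. P \<epsilon> (dz \<epsilon> z t) = Phi F (fst \<Delta>) (z t) - snd \<Delta>)"

definition R_set :: "(real \<Rightarrow> real) \<Rightarrow> real \<Rightarrow> real \<Rightarrow> real \<Rightarrow> real set" where
  "R_set F a b \<delta> = {alpha0 F a b + \<delta>..beta0 F a b - \<delta>}"

definition maxwell_solution ::
    "(real \<Rightarrow> real) \<Rightarrow> real \<Rightarrow> real \<Rightarrow> (real \<times> real) set \<Rightarrow> real \<Rightarrow> real \<Rightarrow> (real \<Rightarrow> real) \<Rightarrow> bool" where
  "maxwell_solution F a b N \<epsilon> r z \<longleftrightarrow> (\<exists>\<Delta>\<in>N. simple_solution_pair F a b \<epsilon> r z \<Delta>)"

text \<open>The Maxwell solutions for \<open>\<delta>\<close> are singled out by a threshold \<open>\<epsilon>1\<close> and a neighbourhood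
  \<open>N\<close> of the Maxwell point with the following property. Uniqueness of a solution refers
  to its values on \<open>ival \<epsilon>\<close>.\<close>

definition maxwell_neighbourhood ::
    "(real \<Rightarrow> real) \<Rightarrow> real \<Rightarrow> real \<Rightarrow> real \<Rightarrow> real \<Rightarrow> (real \<times> real) set \<Rightarrow> bool" where
  "maxwell_neighbourhood F a b \<delta> \<epsilon>1 N \<longleftrightarrow>
     0 < \<epsilon>1 \<and> maxwell_point F a b \<in> interior N \<and>
     (\<forall>\<epsilon>\<in>{0<..<\<epsilon>1}. \<forall>r\<in>R_set F a b \<delta>.
        (\<exists>z. maxwell_solution F a b N \<epsilon> r z) \<and>
        (\<forall>z w. maxwell_solution F a b N \<epsilon> r z \<and> maxwell_solution F a b N \<epsilon> r w
            \<longrightarrow> (\<forall>t\<in>ival \<epsilon>. z t = w t))) \<and>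
     (\<exists>C>0. \<exists>K. \<exists>\<epsilon>2>0. \<forall>\<epsilon>\<in>{0<..<min \<epsilon>1 \<epsilon>2}. \<forall>r\<in>R_set F a b \<delta>. \<forall>z. \<forall>\<Delta>\<in>N.
        simple_solution_pair F a b \<epsilon> r z \<Delta> \<longrightarrow>
        norm (\<Delta> - maxwell_point F a b) \<le> K * exp (- C / \<epsilon>))"

definition energy :: "(real \<Rightarrow> real) \<Rightarrow> real \<Rightarrow> (real \<Rightarrow> real) \<Rightarrow> real" where
  "energy F \<epsilon> z = \<epsilon> * integral (ival \<epsilon>) (\<lambda>t. Q (\<epsilon> * dz \<epsilon> z t) / \<epsilon>\<^sup>2 + F (z t))"

end

theory Submission
  imports Defs
begin

text \<open>The mass constraint turns the energy into an increasing affine function of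
  \<open>J \<epsilon> z\<close>, the integral of \<open>Q (\<epsilon> z') / \<epsilon>\<^sup>2 + G z\<close> with the nonnegative double well
  \<open>G = Phi F \<sigma>\<^sub>0 - b\<^sub>0\<close> vanishing only at \<open>\<alpha>\<^sub>0\<close> and \<open>\<beta>\<^sub>0\<close>. Because the pair of a
  Maxwell solution is exponentially close to the Maxwell point, its \<open>J\<close> stays bounded as
  \<open>\<epsilon> \<rightarrow> 0\<close>. A simple solution with at most that \<open>J\<close> has a small integrand away from a set of
  bounded measure in an interval of length \<open>2 / \<epsilon>\<close>; as its mean \<open>r\<close> is bounded away from both
  wells, it comes close to \<open>\<alpha>\<^sub>0\<close> and to \<open>\<beta>\<^sub>0\<close> with small slope. The first integral at two
  such points forces its pair into the given neighbourhood of the Maxwell point, so it is the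
  Maxwell solution by uniqueness.\<close>

section \<open>Branches of \<open>deriv F\<close> and critical points of
  \<open>Phi F \<sigma>\<close>\<close>

text \<open>The limits of \<open>deriv F\<close> at 0 and at infinity enter as one witness each, in
  \<open>low\<close> and \<open>high\<close>. They make the outer branches of \<open>deriv F\<close>
  reach every value between \<open>deriv F b\<close> and \<open>deriv F a\<close>, so the outer
  critical points exist.\<close>

locale double_well =
  fixes F :: "real \<Rightarrow> real" and a b :: real
  assumes a_pos: "0 < a" and a_less_b: "a < b"
    and smooth: "C_k_on 2 F {0<..}"
    and convex: "\<And>x. x \<in> {0<..<a} \<union> {b<..} \<Longrightarrow> (deriv ^^ 2) F x > 0"
    and concave: "\<And>x. x \<in> {a<..<b} \<Longrightarrow> (deriv ^^ 2) F x < 0"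
    and low: "\<exists>x\<in>{0<..<a}. deriv F x < deriv F b"
    and high: "\<exists>x>b. deriv F a < deriv F x"
begin

lemma DERIV_F: "0 < x \<Longrightarrow> (F has_real_derivative deriv F x) (at x)"
  using smooth unfolding C_k_on_def
  by (metis DERIV_deriv_iff_real_differentiable funpow_0 greaterThan_iff zero_less_numeral)

lemma DERIV_F': "0 < x \<Longrightarrow> (deriv F has_real_derivative (deriv ^^ 2) F x) (at x)"
proof -
  assume "0 < x"
  then have "(deriv ^^ 1) F differentiable (at x)"
    using smooth unfolding C_k_on_def by (metis greaterThan_iff one_less_numeral_iff semiring_norm(76))
  then show ?thesis
    by (simp add: DERIV_deriv_iff_real_differentiable numeral_2_eq_2)
qed

lemma continuous_F: "continuous_on {0<..} F"
  using DERIV_F by (meson DERIV_isCont continuous_at_imp_continuous_on greaterThan_iff)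

lemma continuous_F': "continuous_on {0<..} (deriv F)"
  using DERIV_F' by (meson DERIV_isCont continuous_at_imp_continuous_on greaterThan_iff)

lemma continuous_F'': "continuous_on {0<..} ((deriv ^^ 2) F)"
  using smooth unfolding C_k_on_def by blast

lemma continuous_F'_Icc: "0 < x \<Longrightarrow> continuous_on {x..y} (deriv F)"
  by (rule continuous_on_subset[OF continuous_F']) auto

lemma deriv_less_left:
  assumes "0 < x" "x < y" "y \<le> a"
  shows "deriv F x < deriv F y"
proof (rule DERIV_pos_imp_increasing_open[OF assms(2)])
  show "\<exists>d. (deriv F has_real_derivative d) (at z) \<and> 0 < d" if "x < z" "z < y" for z
    using that assms by (intro exI[of _ "(deriv ^^ 2) F z"] conjI DERIV_F' convex) auto
qed (use assms continuous_F'_Icc in auto)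

lemma deriv_less_right:
  assumes "b \<le> x" "x < y"
  shows "deriv F x < deriv F y"
proof (rule DERIV_pos_imp_increasing_open[OF assms(2)])
  show "\<exists>d. (deriv F has_real_derivative d) (at z) \<and> 0 < d" if "x < z" "z < y" for z
    using that assms a_pos a_less_b by (intro exI[of _ "(deriv ^^ 2) F z"] conjI DERIV_F' convex) auto
qed (use assms a_pos a_less_b continuous_F'_Icc in auto)

lemma deriv_less_mid:
  assumes "a \<le> x" "x < y" "y \<le> b"
  shows "deriv F y < deriv F x"
proof (rule DERIV_neg_imp_decreasing_open[OF assms(2)])
  show "\<exists>d. (deriv F has_real_derivative d) (at z) \<and> d < 0" if "x < z" "z < y" for z
    using that assms a_pos by (intro exI[of _ "(deriv ^^ 2) F z"] conjI DERIV_F' concave) auto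
qed (use assms a_pos continuous_F'_Icc in auto)

lemma DERIV_Phi: "0 < x \<Longrightarrow> (Phi F \<sigma> has_real_derivative deriv F x - \<sigma>) (at x)"
  unfolding Phi_def by (auto intro!: derivative_eq_intros DERIV_F)

lemma continuous_Phi: "continuous_on {0<..} (Phi F \<sigma>)"
  unfolding Phi_def by (intro continuous_intros continuous_F)

lemma Phi_less_increasing:
  assumes "0 < x" "x < y" "\<And>z. x < z \<Longrightarrow> z < y \<Longrightarrow> \<sigma> < deriv F z"
  shows "Phi F \<sigma> x < Phi F \<sigma> y"
proof (rule DERIV_pos_imp_increasing_open[OF assms(2)])
  show "\<exists>d. (Phi F \<sigma> has_real_derivative d) (at z) \<and> 0 < d" if "x < z" "z < y" for z
    using DERIV_Phi[of z] assms that by (intro exI[of _ "deriv F z - \<sigma>"]) auto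
  show "continuous_on {x..y} (Phi F \<sigma>)"
    using assms by (intro continuous_on_subset[OF continuous_Phi]) auto
qed

lemma Phi_less_decreasing:
  assumes "0 < x" "x < y" "\<And>z. x < z \<Longrightarrow> z < y \<Longrightarrow> deriv F z < \<sigma>"
  shows "Phi F \<sigma> y < Phi F \<sigma> x"
proof (rule DERIV_neg_imp_decreasing_open[OF assms(2)])
  show "\<exists>d. (Phi F \<sigma> has_real_derivative d) (at z) \<and> d < 0" if "x < z" "z < y" for z
    using DERIV_Phi[of z] assms that by (intro exI[of _ "deriv F z - \<sigma>"]) auto
  show "continuous_on {x..y} (Phi F \<sigma>)"
    using assms by (intro continuous_on_subset[OF continuous_Phi]) auto
qed

abbreviation "\<alpha> \<equiv> crit_alpha F a"
abbreviation "\<zeta> \<equiv> crit_zeta F a b"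
abbreviation "\<beta> \<equiv> crit_beta F b"
abbreviation "range\<sigma> \<equiv> {deriv F b..deriv F a}"

text \<open>The intermediate value theorem, started at the witness from \<open>low\<close>, gives
  existence; strict monotonicity on the branch gives uniqueness, so the description
  \<open>THE\<close> denotes. The other two critical points are treated alike.\<close>

lemma crit_alpha:
  assumes "\<sigma> \<in> range\<sigma>"
  shows "0 < \<alpha> \<sigma>" "\<alpha> \<sigma> \<le> a" "deriv F (\<alpha> \<sigma>) = \<sigma>"
proof -
  obtain x where x: "0 < x" "x < a" "deriv F x < deriv F b"
    using low by auto
  then obtain z where z: "x \<le> z" "z \<le> a" "deriv F z = \<sigma>"
    using IVT'[of "deriv F" x \<sigma> a] assms continuous_F'_Icc[of x a] by auto
  have "\<exists>!z. z \<in> {0<..a} \<and> deriv F z = \<sigma>"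
  proof (rule ex1I[of _ z])
    show "y = z" if "y \<in> {0<..a} \<and> deriv F y = \<sigma>" for y
      using deriv_less_left[of y z] deriv_less_left[of z y] that z x
      by (cases y z rule: linorder_cases) auto
  qed (use z x in auto)
  from theI'[OF this] show "0 < \<alpha> \<sigma>" "\<alpha> \<sigma> \<le> a" "deriv F (\<alpha> \<sigma>) = \<sigma>"
    unfolding crit_alpha_def by auto
qed

lemma crit_beta:
  assumes "\<sigma> \<in> range\<sigma>"
  shows "b \<le> \<beta> \<sigma>" "deriv F (\<beta> \<sigma>) = \<sigma>"
proof -
  obtain x where x: "b < x" "deriv F a < deriv F x"
    using high by auto
  then obtain z where z: "b \<le> z" "z \<le> x" "deriv F z = \<sigma>"
    using IVT'[of "deriv F" b \<sigma> x] assms a_pos a_less_b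
      continuous_F'_Icc[of b x] by auto
  have "\<exists>!z. z \<in> {b..} \<and> deriv F z = \<sigma>"
    using z x deriv_less_right
    by (intro ex1I[of _ z]) (auto, metis linorder_neqE_linordered_idom order_less_irrefl)
  from theI'[OF this] show "b \<le> \<beta> \<sigma>" "deriv F (\<beta> \<sigma>) = \<sigma>"
    unfolding crit_beta_def by auto
qed

lemma crit_zeta:
  assumes "\<sigma> \<in> range\<sigma>"
  shows "a \<le> \<zeta> \<sigma>" "\<zeta> \<sigma> \<le> b" "deriv F (\<zeta> \<sigma>) = \<sigma>"
proof -
  obtain z where z: "a \<le> z" "z \<le> b" "deriv F z = \<sigma>"
    using IVT2'[of "deriv F" b \<sigma> a] assms a_pos a_less_b
      continuous_F'_Icc[of a b] by auto
  have "\<exists>!z. z \<in> {a..b} \<and> deriv F z = \<sigma>"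
    using z deriv_less_mid
    by (intro ex1I[of _ z]) (auto, metis linorder_neqE_linordered_idom order_less_irrefl)
  from theI'[OF this] show "a \<le> \<zeta> \<sigma>" "\<zeta> \<sigma> \<le> b" "deriv F (\<zeta> \<sigma>) = \<sigma>"
    unfolding crit_zeta_def by auto
qed

text \<open>Between consecutive critical points \<open>deriv F\<close> turns once, at
  \<open>a\<close> or at \<open>b\<close>; splitting there leaves monotone branches, each ending at
  a critical point, where the value is \<sigma>.\<close>

lemma deriv_sign:
  assumes "\<sigma> \<in> range\<sigma>"
  shows "0 < z \<Longrightarrow> z < \<alpha> \<sigma> \<Longrightarrow> deriv F z < \<sigma>"
    and "\<alpha> \<sigma> < z \<Longrightarrow> z < \<zeta> \<sigma> \<Longrightarrow> \<sigma> < deriv F z"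
    and "\<zeta> \<sigma> < z \<Longrightarrow> z < \<beta> \<sigma> \<Longrightarrow> deriv F z < \<sigma>"
    and "\<beta> \<sigma> < z \<Longrightarrow> \<sigma> < deriv F z"
proof -
  note c = crit_alpha[OF assms] crit_beta[OF assms] crit_zeta[OF assms]
  show "0 < z \<Longrightarrow> z < \<alpha> \<sigma> \<Longrightarrow> deriv F z < \<sigma>"
    using deriv_less_left[of z "\<alpha> \<sigma>"] c by simp
  show "\<alpha> \<sigma> < z \<Longrightarrow> z < \<zeta> \<sigma> \<Longrightarrow> \<sigma> < deriv F z"
    using deriv_less_left[of "\<alpha> \<sigma>" z] deriv_less_mid[of z "\<zeta> \<sigma>"] c by (cases "z \<le> a") auto
  show "\<zeta> \<sigma> < z \<Longrightarrow> z < \<beta> \<sigma> \<Longrightarrow> deriv F z < \<sigma>"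
    using deriv_less_mid[of "\<zeta> \<sigma>" z] deriv_less_right[of z "\<beta> \<sigma>"] c by (cases "z \<le> b") auto
  show "\<beta> \<sigma> < z \<Longrightarrow> \<sigma> < deriv F z"
    using deriv_less_right[of "\<beta> \<sigma>" z] c by simp
qed

lemma Phi_monotone:
  assumes "\<sigma> \<in> range\<sigma>"
  shows "0 < x \<Longrightarrow> x < y \<Longrightarrow> y \<le> \<alpha> \<sigma> \<Longrightarrow> Phi F \<sigma> y < Phi F \<sigma> x"
    and "\<alpha> \<sigma> \<le> x \<Longrightarrow> x < y \<Longrightarrow> y \<le> \<zeta> \<sigma> \<Longrightarrow> Phi F \<sigma> x < Phi F \<sigma> y"
    and "\<zeta> \<sigma> \<le> x \<Longrightarrow> x < y \<Longrightarrow> y \<le> \<beta> \<sigma> \<Longrightarrow> Phi F \<sigma> y < Phi F \<sigma> x"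
    and "\<beta> \<sigma> \<le> x \<Longrightarrow> x < y \<Longrightarrow> Phi F \<sigma> x < Phi F \<sigma> y"
proof -
  note c = crit_alpha[OF assms] crit_beta[OF assms] crit_zeta[OF assms] a_pos a_less_b deriv_sign[OF assms]
  show "0 < x \<Longrightarrow> x < y \<Longrightarrow> y \<le> \<alpha> \<sigma> \<Longrightarrow> Phi F \<sigma> y < Phi F \<sigma> x"
    using c by (intro Phi_less_decreasing) auto
  show "\<alpha> \<sigma> \<le> x \<Longrightarrow> x < y \<Longrightarrow> y \<le> \<zeta> \<sigma> \<Longrightarrow> Phi F \<sigma> x < Phi F \<sigma> y"
    using c by (intro Phi_less_increasing) auto
  show "\<zeta> \<sigma> \<le> x \<Longrightarrow> x < y \<Longrightarrow> y \<le> \<beta> \<sigma> \<Longrightarrow> Phi F \<sigma> y < Phi F \<sigma> x"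
    using c by (intro Phi_less_decreasing) auto
  show "\<beta> \<sigma> \<le> x \<Longrightarrow> x < y \<Longrightarrow> Phi F \<sigma> x < Phi F \<sigma> y"
    using c by (intro Phi_less_increasing) auto
qed

lemma Phi_alpha_le:
  assumes "\<sigma> \<in> range\<sigma>" "0 < z" "z \<le> \<zeta> \<sigma>"
  shows "Phi F \<sigma> (\<alpha> \<sigma>) \<le> Phi F \<sigma> z"
  using Phi_monotone(1)[OF assms(1), of z "\<alpha> \<sigma>"] Phi_monotone(2)[OF assms(1), of "\<alpha> \<sigma>" z] assms
  by (cases z "\<alpha> \<sigma>" rule: linorder_cases) auto

lemma Phi_beta_le:
  assumes "\<sigma> \<in> range\<sigma>" "\<zeta> \<sigma> \<le> z"
  shows "Phi F \<sigma> (\<beta> \<sigma>) \<le> Phi F \<sigma> z"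
  using Phi_monotone(3)[OF assms(1), of z "\<beta> \<sigma>"] Phi_monotone(4)[OF assms(1), of "\<beta> \<sigma>" z] assms
  by (cases z "\<beta> \<sigma>" rule: linorder_cases) auto

section \<open>The Maxwell multiplier as the zero of the depth difference\<close>

definition gap :: "real \<Rightarrow> real" where
  "gap \<sigma> = Phi F \<sigma> (\<alpha> \<sigma>) - Phi F \<sigma> (\<beta> \<sigma>)"

text \<open>The minima of \<open>Phi F \<sigma>\<close> over the two wells are infima of affine functions of \<open>\<sigma>\<close> with
  slopes \<open>-z\<close>, and \<open>z\<close> ranges over points left of \<open>a\<close>, respectively right of \<open>b\<close>.\<close>

lemma gap_growth:
  assumes s: "\<sigma> \<in> range\<sigma>" "\<tau> \<in> range\<sigma>" "\<sigma> < \<tau>"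
  shows "(\<tau> - \<sigma>) * (b - a) \<le> gap \<tau> - gap \<sigma>" "gap \<tau> - gap \<sigma> \<le> (\<tau> - \<sigma>) * \<beta> (deriv F a)"
proof -
  note A = crit_alpha[OF s(1)] crit_alpha[OF s(2)] and B = crit_beta[OF s(1)] crit_beta[OF s(2)]
    and Z = crit_zeta[OF s(1)] crit_zeta[OF s(2)]
  have 1: "Phi F \<sigma> (\<alpha> \<sigma>) \<le> Phi F \<sigma> (\<alpha> \<tau>)" "Phi F \<tau> (\<alpha> \<tau>) \<le> Phi F \<tau> (\<alpha> \<sigma>)"
    "Phi F \<sigma> (\<beta> \<sigma>) \<le> Phi F \<sigma> (\<beta> \<tau>)" "Phi F \<tau> (\<beta> \<tau>) \<le> Phi F \<tau> (\<beta> \<sigma>)"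
    using A B Z s by (auto intro!: Phi_alpha_le Phi_beta_le)
  have "\<beta> \<tau> \<le> \<beta> (deriv F a)"
    using deriv_sign(4)[of "deriv F a" "\<beta> \<tau>"] B s by (force simp: not_le)
  then have 2: "(\<tau> - \<sigma>) * \<alpha> \<tau> \<le> (\<tau> - \<sigma>) * a" "(\<tau> - \<sigma>) * b \<le> (\<tau> - \<sigma>) * \<beta> \<sigma>"
    "0 \<le> (\<tau> - \<sigma>) * \<alpha> \<sigma>" "(\<tau> - \<sigma>) * \<beta> \<tau> \<le> (\<tau> - \<sigma>) * \<beta> (deriv F a)"
    using A B s by auto
  show "(\<tau> - \<sigma>) * (b - a) \<le> gap \<tau> - gap \<sigma>" "gap \<tau> - gap \<sigma> \<le> (\<tau> - \<sigma>) * \<beta> (deriv F a)"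
    using 1 2 unfolding gap_def Phi_def by (simp_all add: algebra_simps)
qed

lemma range_nonempty: "deriv F b < deriv F a"
  using deriv_less_mid[of a b] a_less_b by simp

text \<open>The upper estimate of \<open>gap_growth\<close> is a Lipschitz bound; the lower one
  fixes the sign of the increment, so the bound also holds for its absolute value.\<close>

lemma continuous_gap: "continuous_on range\<sigma> gap"
proof -
  define L where "L = \<beta> (deriv F a)"
  have L: "0 \<le> L"
    using crit_beta[of "deriv F a"] a_pos a_less_b range_nonempty unfolding L_def by auto
  have *: "dist (gap x) (gap y) \<le> L * dist x y" if "x \<in> range\<sigma>" "y \<in> range\<sigma>" "x < y" for x y
  proof -
    have "0 \<le> (y - x) * (b - a)" using that a_less_b by simp
    then show ?thesis
      using gap_growth[OF that] that unfolding L_def dist_real_def by (simp add: mult.commute)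
  qed
  have "L-lipschitz_on range\<sigma> gap"
    unfolding lipschitz_on_def
  proof (intro conjI ballI)
    fix x y assume "x \<in> range\<sigma>" "y \<in> range\<sigma>"
    then show "dist (gap x) (gap y) \<le> L * dist x y"
      using *[of x y] *[of y x] by (cases x y rule: linorder_cases) (auto simp: dist_commute)
  qed (rule L)
  then show ?thesis by (rule lipschitz_on_continuous_on)
qed

text \<open>At either end of the range the middle critical point merges with an outer one at an
  inflection point, so a single monotone stretch of \<open>Phi F \<sigma>\<close> joins
  \<open>\<alpha> \<sigma>\<close> to \<open>\<beta> \<sigma>\<close>.\<close>

lemma gap_ends: "gap (deriv F b) < 0" "0 < gap (deriv F a)"
proof -
  have r: "deriv F b \<in> range\<sigma>" "deriv F a \<in> range\<sigma>"
    using range_nonempty by auto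
  note A = crit_alpha[OF r(1)] crit_alpha[OF r(2)] and B = crit_beta[OF r(1)] crit_beta[OF r(2)]
    and Z = crit_zeta[OF r(1)] crit_zeta[OF r(2)]
  have "\<beta> (deriv F b) = b"
    using deriv_less_right[of b "\<beta> (deriv F b)"] B by force
  moreover have "\<zeta> (deriv F b) = b"
    using deriv_less_mid[of "\<zeta> (deriv F b)" b] Z by force
  ultimately show "gap (deriv F b) < 0"
    using Phi_monotone(2)[OF r(1), of "\<alpha> (deriv F b)" b] A a_less_b unfolding gap_def by auto
  have "\<alpha> (deriv F a) = a"
    using deriv_less_left[of "\<alpha> (deriv F a)" a] A by force
  moreover have "\<zeta> (deriv F a) = a"
    using deriv_less_mid[of a "\<zeta> (deriv F a)"] Z by force
  ultimately show "0 < gap (deriv F a)"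
    using Phi_monotone(3)[OF r(2), of a "\<beta> (deriv F a)"] B a_less_b unfolding gap_def by auto
qed

abbreviation "\<sigma>\<^sub>0 \<equiv> sigma0 F a b"
abbreviation "\<alpha>\<^sub>0 \<equiv> alpha0 F a b"
abbreviation "\<beta>\<^sub>0 \<equiv> beta0 F a b"
abbreviation "\<zeta>\<^sub>0 \<equiv> \<zeta> \<sigma>\<^sub>0"
abbreviation "b\<^sub>0 \<equiv> Phi F \<sigma>\<^sub>0 \<alpha>\<^sub>0"

text \<open>The sign change of \<open>gap\<close> yields a zero, and growth at rate at least
  \<open>b - a > 0\<close> rules out a second one.\<close>

lemma sigma0: "deriv F b < \<sigma>\<^sub>0" "\<sigma>\<^sub>0 < deriv F a" "Phi F \<sigma>\<^sub>0 \<beta>\<^sub>0 = b\<^sub>0"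
proof -
  obtain s where s: "s \<in> range\<sigma>" "gap s = 0"
    using IVT'[of gap "deriv F b" 0 "deriv F a"] gap_ends continuous_gap range_nonempty by force
  have "\<exists>!\<sigma>. \<sigma> \<in> {deriv F b<..<deriv F a} \<and> Phi F \<sigma> (\<alpha> \<sigma>) = Phi F \<sigma> (\<beta> \<sigma>)"
  proof (rule ex1I[of _ s])
    show "s \<in> {deriv F b<..<deriv F a} \<and> Phi F s (\<alpha> s) = Phi F s (\<beta> s)"
      using s gap_ends by (auto simp: gap_def less_le)
    fix t assume t: "t \<in> {deriv F b<..<deriv F a} \<and> Phi F t (\<alpha> t) = Phi F t (\<beta> t)"
    then have "gap t = 0" "t \<in> range\<sigma>" by (auto simp: gap_def)
    then show "t = s"
      using gap_growth(1)[of s t] gap_growth(1)[of t s] s a_less_b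
      by (cases s t rule: linorder_cases) (auto simp: mult_le_0_iff)
  qed
  from theI'[OF this] show "deriv F b < \<sigma>\<^sub>0" "\<sigma>\<^sub>0 < deriv F a" "Phi F \<sigma>\<^sub>0 \<beta>\<^sub>0 = b\<^sub>0"
    unfolding sigma0_def[symmetric] alpha0_def beta0_def by auto
qed

lemma sigma0_range: "\<sigma>\<^sub>0 \<in> range\<sigma>"
  using sigma0 by auto

text \<open>Strictness comes from \<open>\<sigma>\<^sub>0\<close> lying in the open range: a
  critical point at \<open>a\<close> or \<open>b\<close> would make it an end value.\<close>

lemma crit0:
  "0 < \<alpha>\<^sub>0" "\<alpha>\<^sub>0 < \<zeta>\<^sub>0" "\<zeta>\<^sub>0 < \<beta>\<^sub>0" "\<alpha>\<^sub>0 < a" "b < \<beta>\<^sub>0"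
  "deriv F \<alpha>\<^sub>0 = \<sigma>\<^sub>0" "deriv F \<beta>\<^sub>0 = \<sigma>\<^sub>0"
proof -
  note c = crit_alpha[OF sigma0_range, folded alpha0_def] crit_beta[OF sigma0_range, folded beta0_def]
    crit_zeta[OF sigma0_range]
  have "\<alpha>\<^sub>0 \<noteq> a" "\<zeta>\<^sub>0 \<noteq> b" "\<beta>\<^sub>0 \<noteq> b"
    using c sigma0 by auto
  with c show "0 < \<alpha>\<^sub>0" "\<alpha>\<^sub>0 < \<zeta>\<^sub>0" "\<zeta>\<^sub>0 < \<beta>\<^sub>0" "\<alpha>\<^sub>0 < a" "b < \<beta>\<^sub>0"
    "deriv F \<alpha>\<^sub>0 = \<sigma>\<^sub>0" "deriv F \<beta>\<^sub>0 = \<sigma>\<^sub>0"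
    by linarith+
qed

end

section \<open>Calculus of \<open>Q\<close> and \<open>P\<close>\<close>

lemma one_plus_square [simp]:
  fixes x :: real
  shows "0 < 1 + x\<^sup>2" "1 + x\<^sup>2 \<noteq> 0" "\<not> 1 + x\<^sup>2 < 0"
  by (simp_all add: add_pos_nonneg add_nonneg_eq_0_iff not_less)

lemma DERIV_sqrt_one_plus: "((\<lambda>s. sqrt (1 + s\<^sup>2)) has_real_derivative s / sqrt (1 + s\<^sup>2)) (at s)"
  by (auto intro!: derivative_eq_intros simp: field_simps)

lemma deriv_Q: "deriv Q = (\<lambda>s. s / sqrt (1 + s\<^sup>2))"
  unfolding Q_def[abs_def]
  using DERIV_diff[OF DERIV_sqrt_one_plus DERIV_const] by (intro ext DERIV_imp_deriv) simp

lemma deriv2_Q: "(deriv ^^ 2) Q s = 1 / sqrt (1 + s\<^sup>2) ^ 3"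
proof -
  define x where "x = sqrt (1 + s\<^sup>2)"
  have x: "0 < x" "x * x = 1 + s * s"
    by (simp_all add: x_def flip: power2_eq_square)
  have "((\<lambda>s. s / sqrt (1 + s\<^sup>2)) has_real_derivative (1 * x - s * (s / x)) / (x * x)) (at s)"
    using DERIV_divide[OF DERIV_ident DERIV_sqrt_one_plus] by (simp add: x_def)
  also have "(1 * x - s * (s / x)) / (x * x) = 1 / x ^ 3"
  proof -
    have "1 * x - s * (s / x) = 1 / x" using x by (simp add: field_simps)
    then show ?thesis by (simp add: power3_eq_cube)
  qed
  finally show ?thesis
    by (simp add: numeral_2_eq_2 deriv_Q DERIV_imp_deriv x_def)
qed

lemma P_eq: "P \<epsilon> s = (1 / \<epsilon>\<^sup>2) * (1 - 1 / sqrt (1 + (\<epsilon> * s)\<^sup>2))"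
  by (simp add: P_def power_mult_distrib)

text \<open>The derivative is \<open>s * Q''(\<epsilon> * s)\<close>. Hence, along a solution,
  \<open>P \<epsilon> (z')\<close> and \<open>Phi F \<sigma> z\<close> have the same
  derivative.\<close>

lemma DERIV_P:
  assumes "\<epsilon> \<noteq> 0"
  shows "(P \<epsilon> has_real_derivative s / sqrt (1 + (\<epsilon> * s)\<^sup>2) ^ 3) (at s)"
proof -
  have "((\<lambda>s. \<epsilon> * s) has_real_derivative \<epsilon>) (at s)"
    by (auto intro!: derivative_eq_intros)
  from DERIV_chain2[OF DERIV_sqrt_one_plus this]
  have "((\<lambda>s. sqrt (1 + (\<epsilon> * s)\<^sup>2)) has_real_derivative \<epsilon> * s / sqrt (1 + (\<epsilon> * s)\<^sup>2) * \<epsilon>) (at s)" .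
  moreover define X where "X = (\<lambda>s. sqrt (1 + (\<epsilon> * s)\<^sup>2))"
  ultimately have "(X has_real_derivative \<epsilon> * s / X s * \<epsilon>) (at s)" "X s \<noteq> 0"
    by simp_all
  then show ?thesis
    unfolding P_eq[abs_def] X_def[THEN fun_cong, symmetric] using assms
    by (auto intro!: derivative_eq_intros simp: power3_eq_cube power2_eq_square)
qed

text \<open>The identity \<open>(\<epsilon> * s)^2 = (x - 1) * (x + 1)\<close> for the square root
  \<open>x\<close> cancels the singular factor and exhibits \<open>P\<close> as quadratic in
  \<open>s\<close> up to a weight.\<close>

lemma P_rational:
  assumes "\<epsilon> \<noteq> 0"
  shows "P \<epsilon> s = s\<^sup>2 / (sqrt (1 + (\<epsilon> * s)\<^sup>2) * (1 + sqrt (1 + (\<epsilon> * s)\<^sup>2)))"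
proof -
  define x where "x = sqrt (1 + (\<epsilon> * s)\<^sup>2)"
  have x: "x > 0" "\<epsilon>\<^sup>2 * s\<^sup>2 = (x - 1) * (x + 1)"
    unfolding x_def by (auto simp: algebra_simps power_mult_distrib add_pos_nonneg simp flip: power2_eq_square)
  have "s\<^sup>2 = (x - 1) * (x + 1) / \<epsilon>\<^sup>2"
    using x(2) assms by (simp add: field_simps)
  then show ?thesis
    using x(1) assms unfolding P_eq x_def[symmetric] by (simp add: divide_simps)
qed

lemma P_nonneg: "\<epsilon> \<noteq> 0 \<Longrightarrow> 0 \<le> P \<epsilon> s"
  by (simp add: P_rational add_nonneg_nonneg)

text \<open>In terms of the square root \<open>x\<close> this is \<open>1 - 1 / x <= x - 1\<close>,
  that is, \<open>(x - 1)^2 >= 0\<close>. It lets a small energy density force a small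
  \<open>P\<close>.\<close>

lemma P_le_Q: "\<epsilon> \<noteq> 0 \<Longrightarrow> P \<epsilon> s \<le> Q (\<epsilon> * s) / \<epsilon>\<^sup>2"
proof -
  define x where "x = sqrt (1 + (\<epsilon> * s)\<^sup>2)"
  have "1 \<le> x" unfolding x_def by simp
  then have "2 * x \<le> x * x + 1 \<and> 0 < x" using zero_le_square[of "x - 1"] by (simp add: algebra_simps)
  then have "1 - 1 / x \<le> x - 1" by (simp add: field_simps)
  then show ?thesis
    unfolding P_eq Q_def x_def[symmetric] by (simp add: divide_right_mono)
qed

lemma Q_nonneg: "0 \<le> Q s"
  by (simp add: Q_def)

text \<open>The left side equals \<open>s * (s / x)\<close>, and \<open>s / x\<close> is controlled
  through \<open>(s / x)^2 <= 2 * P\<close>. The bound is linear in \<open>s\<close> with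
  coefficients free of powers of \<epsilon>, so for bounded \<open>P\<close> its integral over the
  long interval only costs the total increase of \<open>z\<close>.\<close>

lemma Q_plus_P_le:
  assumes "\<epsilon> \<noteq> 0" "0 \<le> s"
  shows "Q (\<epsilon> * s) / \<epsilon>\<^sup>2 + P \<epsilon> s \<le> s * (1 + 2 * P \<epsilon> s)"
proof -
  define x where "x = sqrt (1 + (\<epsilon> * s)\<^sup>2)"
  have x: "1 \<le> x" "\<epsilon>\<^sup>2 * s\<^sup>2 = (x - 1) * (x + 1)"
    unfolding x_def by (auto simp: algebra_simps power_mult_distrib add_pos_nonneg simp flip: power2_eq_square)
  then have s2: "s\<^sup>2 = (x - 1) * (x + 1) / \<epsilon>\<^sup>2"
    using assms by (simp add: field_simps)
  have "Q (\<epsilon> * s) / \<epsilon>\<^sup>2 + P \<epsilon> s = (x - 1 / x) / \<epsilon>\<^sup>2"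
    unfolding P_eq Q_def x_def[symmetric] by (simp add: diff_divide_distrib)
  also have "x - 1 / x = (x - 1) * (x + 1) / x"
    using x(1) by (simp add: field_simps)
  also have "\<dots> / \<epsilon>\<^sup>2 = s\<^sup>2 / x"
    by (simp add: s2)
  also have "\<dots> = s * (s / x)"
    by (simp add: power2_eq_square)
  also have "\<dots> \<le> s * (1 + 2 * P \<epsilon> s)"
  proof (rule mult_left_mono[OF _ assms(2)])
    have "y \<le> 1 + y\<^sup>2" for y :: real
      using zero_le_square[of "y - 1 / 2"] by (simp add: power2_eq_square algebra_simps)
    then have "s / x \<le> 1 + (s / x)\<^sup>2" .
    also have "(s / x)\<^sup>2 = P \<epsilon> s * ((x + 1) / x)"
      unfolding P_rational[OF assms(1)] x_def[symmetric] using x(1)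
      by (simp add: power2_eq_square add.commute)
    also have "\<dots> \<le> P \<epsilon> s * 2"
      using x(1) P_nonneg[OF assms(1)] by (intro mult_left_mono) (auto simp: field_simps)
    finally show "s / x \<le> 1 + 2 * P \<epsilon> s" by simp
  qed
  finally show ?thesis .
qed

section \<open>Compactness bound and Gronwall inequalities\<close>

lemma bounded_on_Icc:
  fixes f :: "real \<Rightarrow> real"
  assumes "continuous_on {p..q} f"
  obtains B where "\<And>t. t \<in> {p..q} \<Longrightarrow> \<bar>f t\<bar> \<le> B"
proof -
  have "bounded (f ` {p..q})"
    by (intro compact_imp_bounded compact_continuous_image assms compact_Icc)
  then show ?thesis using that unfolding bounded_iff real_norm_def by blast
qed

text \<open>Multiplied by the integrating factor \<open>exp (- C * t)\<close>, the function
  \<open>w\<close> becomes nonincreasing and starts at 0.\<close>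

lemma gronwall_left:
  fixes w :: "real \<Rightarrow> real"
  assumes "continuous_on {p..q} w" "w p = 0"
    and d: "\<And>t. p < t \<Longrightarrow> t < q \<Longrightarrow> (w has_real_derivative w' t) (at t)"
    and le: "\<And>t. p < t \<Longrightarrow> t < q \<Longrightarrow> w' t \<le> C * w t"
    and t: "t \<in> {p..q}"
  shows "w t \<le> 0"
proof -
  have "w t * exp (- C * t) \<le> w p * exp (- C * p)"
  proof (rule DERIV_nonpos_imp_decreasing_open[of p t "\<lambda>t. w t * exp (- C * t)"])
    show "\<exists>y. ((\<lambda>t. w t * exp (- C * t)) has_real_derivative y) (at x) \<and> y \<le> 0"
      if "p < x" "x < t" for x
      using that t le[of x]
      by (intro exI[of _ "(w' x - C * w x) * exp (- C * x)"] conjI)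
         (auto intro!: derivative_eq_intros d simp: algebra_simps mult_le_0_iff)
    show "continuous_on {p..t} (\<lambda>t. w t * exp (- C * t))"
      using t by (intro continuous_intros continuous_on_subset[OF assms(1)]) auto
  qed (use t in auto)
  then show ?thesis using assms(2) by (simp add: mult_le_0_iff)
qed

lemma gronwall_right:
  fixes w :: "real \<Rightarrow> real"
  assumes "continuous_on {p..q} w" "w q = 0"
    and d: "\<And>t. p < t \<Longrightarrow> t < q \<Longrightarrow> (w has_real_derivative w' t) (at t)"
    and le: "\<And>t. p < t \<Longrightarrow> t < q \<Longrightarrow> - C * w t \<le> w' t"
    and t: "t \<in> {p..q}"
  shows "w t \<le> 0"
proof -
  have "w (- (- t)) \<le> 0"
  proof (rule gronwall_left[of "-q" "-p" "\<lambda>t. w (- t)" "\<lambda>t. - w' (- t)" C])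
    show "continuous_on {- q..- p} (\<lambda>t. w (- t))"
      by (intro continuous_on_compose2[OF assms(1)] continuous_intros) auto
    show "((\<lambda>t. w (- t)) has_real_derivative - w' (- x)) (at x)" if "- q < x" "x < - p" for x
      using d[of "-x"] that by (simp add: DERIV_mirror)
    show "- w' (- x) \<le> C * w (- x)" if "- q < x" "x < - p" for x
      using le[of "-x"] that by auto
  qed (use assms t in auto)
  then show ?thesis by simp
qed

section \<open>A single simple solution: first integral and admissible pair\<close>

locale simple_sol = double_well +
  fixes \<epsilon> r :: real and z :: "real \<Rightarrow> real" and \<sigma> :: real
  assumes eps: "0 < \<epsilon>"
    and simple: "simple_solution F \<epsilon> r z \<sigma>"
begin

abbreviation "L \<equiv> 1 / \<epsilon>"
abbreviation "z' \<equiv> dz \<epsilon> z"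
abbreviation "m \<equiv> z (- L)"
abbreviation "M \<equiv> z L"
text \<open>The constant of the first integral, read off at the left end, where
  \<open>z' = 0\<close> makes \<open>P\<close> vanish.\<close>

definition "c = Phi F \<sigma> m"

lemma L_pos: "0 < L" and ival_ends: "- L \<in> ival \<epsilon>" "L \<in> ival \<epsilon>"
  using eps by (auto simp: ival_def)

lemma sol: "solution F \<epsilon> r z \<sigma>" and mono: "mono_on (ival \<epsilon>) z" and nonconst: "\<not> z constant_on ival \<epsilon>"
  using simple by (auto simp: simple_solution_def)

lemma z_pos: "t \<in> ival \<epsilon> \<Longrightarrow> 0 < z t"
  and z_differentiable: "z differentiable_on ival \<epsilon>"
  and z'_cont: "continuous_on (ival \<epsilon>) z'"
  and z'_ends: "z' (- L) = 0" "z' L = 0"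
  and z_integral: "integral (ival \<epsilon>) z = 2 * r / \<epsilon>"
  using sol by (auto simp: solution_def)

lemma z_between: "t \<in> ival \<epsilon> \<Longrightarrow> m \<le> z t" "t \<in> ival \<epsilon> \<Longrightarrow> z t \<le> M"
  using mono_onD[OF mono ival_ends(1)] mono_onD[OF mono _ ival_ends(2)] by (auto simp: ival_def)

lemma m_pos: "0 < m"
  using z_pos ival_ends by auto

lemma m_less_M: "m < M"
proof (rule ccontr)
  assume "\<not> m < M"
  then have "z t = m" if "t \<in> ival \<epsilon>" for t
    using z_between[OF that] by simp
  then show False using nonconst by (auto simp: constant_on_def)
qed

lemma z_cont: "continuous_on (ival \<epsilon>) z"
  using z_differentiable differentiable_imp_continuous_on by blast

lemma z_vderiv: "t \<in> ival \<epsilon> \<Longrightarrow> (z has_vector_derivative z' t) (at t within ival \<epsilon>)"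
  using z_differentiable unfolding differentiable_on_def dz_def
  by (simp add: vector_derivative_works)

lemma DERIV_z: "- L < t \<Longrightarrow> t < L \<Longrightarrow> (z has_real_derivative z' t) (at t)"
  using z_vderiv[of t] at_within_Icc_at[of "-L" t L]
  by (simp add: ival_def has_real_derivative_iff_has_vector_derivative)

lemma DERIV_z':
  "- L < t \<Longrightarrow> t < L \<Longrightarrow>
    (z' has_real_derivative (deriv F (z t) - \<sigma>) * sqrt (1 + (\<epsilon> * z' t)\<^sup>2) ^ 3) (at t)"
proof -
  assume t: "- L < t" "t < L"
  then have "z' differentiable (at t)"
    and "(deriv ^^ 2) Q (\<epsilon> * z' t) * deriv z' t = deriv F (z t) - \<sigma>"
    using sol unfolding solution_def by auto
  then have d: "(z' has_real_derivative deriv z' t) (at t)"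
    and e: "deriv z' t = (deriv F (z t) - \<sigma>) * sqrt (1 + (\<epsilon> * z' t)\<^sup>2) ^ 3"
    by (simp_all only: DERIV_deriv_iff_real_differentiable, simp add: deriv2_Q divide_eq_eq)
  show ?thesis using d unfolding e .
qed

lemma z'_nonneg: "t \<in> ival \<epsilon> \<Longrightarrow> 0 \<le> z' t"
proof -
  assume t: "t \<in> ival \<epsilon>"
  consider "t = - L" | "t = L" | "- L < t" "t < L"
    using t by (fastforce simp: ival_def)
  then show ?thesis
  proof cases
    case 3
    show ?thesis
      by (rule mono_on_imp_deriv_nonneg[OF mono DERIV_z[OF 3]]) (use 3 in \<open>auto simp: ival_def\<close>)
  qed (simp_all add: z'_ends)
qed

lemma first_integral: "t \<in> ival \<epsilon> \<Longrightarrow> P \<epsilon> (z' t) = Phi F \<sigma> (z t) - c"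
proof -
  assume t: "t \<in> ival \<epsilon>"
  define H where "H t = P \<epsilon> (z' t) - Phi F \<sigma> (z t)" for t
  have P_cont: "continuous_on UNIV (P \<epsilon>)"
    using DERIV_P[of \<epsilon>] eps by (intro continuous_at_imp_continuous_on) (auto dest: DERIV_isCont)
  have "continuous_on (ival \<epsilon>) H"
    unfolding H_def using z_pos
    by (intro continuous_intros continuous_on_compose2[OF P_cont z'_cont]
        continuous_on_compose2[OF continuous_Phi z_cont]) auto
  moreover have "(H has_real_derivative 0) (at x)" if x: "- L < x" "x < L" for x
  proof -
    have "0 < z x" using z_pos x by (auto simp: ival_def)
    from DERIV_chain2[OF DERIV_Phi[OF this] DERIV_z[OF x]]
    have Phi: "((\<lambda>x. Phi F \<sigma> (z x)) has_real_derivative (deriv F (z x) - \<sigma>) * z' x) (at x)" .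
    have "((\<lambda>x. P \<epsilon> (z' x)) has_real_derivative (deriv F (z x) - \<sigma>) * z' x) (at x)"
      using DERIV_chain2[OF DERIV_P DERIV_z'[OF x], of \<epsilon>] eps by (simp add: mult.commute)
    from DERIV_diff[OF this Phi] show ?thesis
      unfolding H_def by simp
  qed
  ultimately have "H t = H (- L)"
    using t L_pos by (intro DERIV_isconst2[of "-L" L]) (auto simp: ival_def)
  then show ?thesis
    using z'_ends by (simp add: H_def c_def P_def)
qed

lemma Phi_ends: "Phi F \<sigma> m = c" "Phi F \<sigma> M = c"
  using first_integral[of L] ival_ends z'_ends by (auto simp: c_def P_def)

text \<open>By \<open>P_rational\<close>, \<open>(z')^2\<close> is \<open>P\<close> times a weight
  that is bounded because \<open>z'\<close> is continuous on a compact interval. \<open>C\<close>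
  may depend on the solution, since it serves in contradiction arguments about one fixed
  solution.\<close>

lemma z'_quadratic:
  obtains C where "0 \<le> C" "\<And>t. t \<in> ival \<epsilon> \<Longrightarrow> (z' t)\<^sup>2 \<le> C * (Phi F \<sigma> (z t) - c)"
proof -
  define X where "X t = sqrt (1 + (\<epsilon> * z' t)\<^sup>2) * (1 + sqrt (1 + (\<epsilon> * z' t)\<^sup>2))" for t
  have "continuous_on (ival \<epsilon>) X"
    unfolding X_def by (intro continuous_intros z'_cont)
  then obtain C where C: "\<And>t. t \<in> ival \<epsilon> \<Longrightarrow> \<bar>X t\<bar> \<le> C"
    unfolding ival_def by (rule bounded_on_Icc) blast
  have "(z' t)\<^sup>2 \<le> C * (Phi F \<sigma> (z t) - c)" if t: "t \<in> ival \<epsilon>" for t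
  proof -
    have "0 < X t" unfolding X_def by (simp add: add_pos_pos)
    moreover have "P \<epsilon> (z' t) = (z' t)\<^sup>2 / X t"
      using eps unfolding X_def by (simp add: P_rational)
    ultimately have "(z' t)\<^sup>2 = X t * P \<epsilon> (z' t)" by simp
    also have "\<dots> \<le> C * P \<epsilon> (z' t)"
      using C[OF t] P_nonneg[of \<epsilon>] eps by (intro mult_right_mono) auto
    finally show ?thesis using first_integral[OF t] by simp
  qed
  moreover have "0 \<le> C" using C[OF ival_ends(1)] by simp
  ultimately show ?thesis using that by blast
qed

lemma F'_lipschitz:
  obtains S where "0 \<le> S" "\<And>x y. m \<le> x \<Longrightarrow> x \<le> y \<Longrightarrow> y \<le> M \<Longrightarrow> \<bar>deriv F y - deriv F x\<bar> \<le> S * (y - x)"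
proof -
  have "continuous_on {m..M} ((deriv ^^ 2) F)"
    by (rule continuous_on_subset[OF continuous_F'']) (use m_pos in force)
  then obtain S where S: "\<And>t. t \<in> {m..M} \<Longrightarrow> \<bar>(deriv ^^ 2) F t\<bar> \<le> S"
    by (rule bounded_on_Icc) blast
  have "\<bar>deriv F y - deriv F x\<bar> \<le> S * (y - x)" if xy: "m \<le> x" "x \<le> y" "y \<le> M" for x y
  proof -
    have "norm (deriv F y - deriv F x) \<le> S * norm (y - x)"
      using xy m_pos S
      by (intro field_differentiable_bound[of "{m..M}" _ "(deriv ^^ 2) F"] has_field_derivative_at_within[OF DERIV_F']) auto
    then show ?thesis using xy by simp
  qed
  moreover have "0 \<le> S" using S[of m] m_less_M by auto
  ultimately show ?thesis using that by blast
qed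

lemma Phi_MVT:
  assumes "0 < x" "x \<le> y"
  obtains \<xi> where "x \<le> \<xi>" "\<xi> \<le> y" "Phi F \<sigma> y - Phi F \<sigma> x = (y - x) * (deriv F \<xi> - \<sigma>)"
proof (cases "x = y")
  case False
  then have "\<exists>\<xi>>x. \<xi> < y \<and> Phi F \<sigma> y - Phi F \<sigma> x = (y - x) * (deriv F \<xi> - \<sigma>)"
    using assms by (intro MVT2 DERIV_Phi) auto
  then show ?thesis using that less_imp_le by blast
qed (use that assms in auto)

text \<open>If the inequality failed, then the first integral would give \<open>z' \<le> C (z - m)\<close>, which
  forces \<open>z\<close> to be constant.\<close>

lemma sigma_less: "\<sigma> < deriv F m"
proof (rule ccontr)
  assume neg: "\<not> \<sigma> < deriv F m"
  obtain C where C: "0 \<le> C" "\<And>t. t \<in> ival \<epsilon> \<Longrightarrow> (z' t)\<^sup>2 \<le> C * (Phi F \<sigma> (z t) - c)"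
    by (rule z'_quadratic) blast
  obtain S where S: "0 \<le> S" "\<And>x y. m \<le> x \<Longrightarrow> x \<le> y \<Longrightarrow> y \<le> M \<Longrightarrow> \<bar>deriv F y - deriv F x\<bar> \<le> S * (y - x)"
    by (rule F'_lipschitz) blast
  have le: "z' t \<le> sqrt (C * S) * (z t - m)" if t: "t \<in> ival \<epsilon>" for t
  proof -
    note b = z_between[OF t]
    obtain \<xi> where \<xi>: "m \<le> \<xi>" "\<xi> \<le> z t" "Phi F \<sigma> (z t) - Phi F \<sigma> m = (z t - m) * (deriv F \<xi> - \<sigma>)"
      using Phi_MVT[OF m_pos b(1)] by blast
    have "S * (\<xi> - m) \<le> S * (z t - m)" using \<xi> S by (intro mult_left_mono) auto
    then have "deriv F \<xi> - \<sigma> \<le> S * (z t - m)"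
      using S(2)[of m \<xi>] \<xi> b neg by auto
    then have "Phi F \<sigma> (z t) - c \<le> (z t - m) * (S * (z t - m))"
      unfolding c_def \<xi> using b by (intro mult_left_mono) auto
    with C(1) have "C * (Phi F \<sigma> (z t) - c) \<le> C * ((z t - m) * (S * (z t - m)))"
      by (rule mult_left_mono[rotated])
    also have "\<dots> = (sqrt (C * S) * (z t - m))\<^sup>2"
      using C(1) S(1) by (simp add: power_mult_distrib power2_eq_square[of "z t - m"])
    finally have "(z' t)\<^sup>2 \<le> (sqrt (C * S) * (z t - m))\<^sup>2"
      using C(2)[OF t] by simp
    then show ?thesis
      by (rule power2_le_imp_le) (use b C(1) S(1) in simp)
  qed
  have "M - m \<le> 0"
    by (rule gronwall_left[of "-L" L "\<lambda>t. z t - m" z' "sqrt (C * S)"])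
      (use L_pos z_cont le in \<open>auto simp: ival_def intro!: continuous_intros derivative_eq_intros DERIV_z\<close>)
  then show False using m_less_M by simp
qed

text \<open>Mirror image of \<open>sigma_less\<close>: otherwise \<open>z'\<close> would be at most
  a multiple of \<open>M - z\<close>, and Gronwall run backwards from \<open>L\<close>, where
  \<open>M - z\<close> vanishes, would give \<open>m = M\<close>.\<close>

lemma deriv_less_sigma: "deriv F M < \<sigma>"
proof (rule ccontr)
  assume neg: "\<not> deriv F M < \<sigma>"
  obtain C where C: "0 \<le> C" "\<And>t. t \<in> ival \<epsilon> \<Longrightarrow> (z' t)\<^sup>2 \<le> C * (Phi F \<sigma> (z t) - c)"
    by (rule z'_quadratic) blast
  obtain S where S: "0 \<le> S" "\<And>x y. m \<le> x \<Longrightarrow> x \<le> y \<Longrightarrow> y \<le> M \<Longrightarrow> \<bar>deriv F y - deriv F x\<bar> \<le> S * (y - x)"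
    by (rule F'_lipschitz) blast
  have le: "z' t \<le> sqrt (C * S) * (M - z t)" if t: "t \<in> ival \<epsilon>" for t
  proof -
    note b = z_between[OF t]
    obtain \<xi> where \<xi>: "z t \<le> \<xi>" "\<xi> \<le> M" "Phi F \<sigma> M - Phi F \<sigma> (z t) = (M - z t) * (deriv F \<xi> - \<sigma>)"
      using Phi_MVT[OF z_pos[OF t] b(2)] by blast
    have "S * (M - \<xi>) \<le> S * (M - z t)" using \<xi> S by (intro mult_left_mono) auto
    then have "\<sigma> - deriv F \<xi> \<le> S * (M - z t)"
      using S(2)[of \<xi> M] \<xi> b neg by auto
    then have "(M - z t) * (\<sigma> - deriv F \<xi>) \<le> (M - z t) * (S * (M - z t))"
      using b by (intro mult_left_mono) auto
    then have "Phi F \<sigma> (z t) - c \<le> (M - z t) * (S * (M - z t))"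
      using \<xi>(3) Phi_ends by (simp add: algebra_simps)
    with C(1) have "C * (Phi F \<sigma> (z t) - c) \<le> C * ((M - z t) * (S * (M - z t)))"
      by (rule mult_left_mono[rotated])
    also have "\<dots> = (sqrt (C * S) * (M - z t))\<^sup>2"
      using C(1) S(1) by (simp add: power_mult_distrib power2_eq_square[of "M - z t"])
    finally have "(z' t)\<^sup>2 \<le> (sqrt (C * S) * (M - z t))\<^sup>2"
      using C(2)[OF t] by simp
    then show ?thesis
      by (rule power2_le_imp_le) (use b C(1) S(1) in simp)
  qed
  have "M - m \<le> 0"
    by (rule gronwall_right[of "-L" L "\<lambda>t. M - z t" "\<lambda>t. - z' t" "sqrt (C * S)"])
      (use L_pos z_cont le in \<open>auto simp: ival_def intro!: continuous_intros derivative_eq_intros DERIV_z\<close>)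
  then show False using m_less_M by simp
qed

text \<open>Otherwise \<open>m\<close> and \<open>M\<close> both lie on the increasing right branch,
  against \<open>deriv F M < \<sigma> < deriv F m\<close>.\<close>

lemma m_less_b: "m < b"
  using deriv_less_right[of m M] m_less_M sigma_less deriv_less_sigma by (cases "b \<le> m") auto

lemma a_less_M: "a < M"
  using deriv_less_left[of m M] m_less_M m_pos sigma_less deriv_less_sigma by (cases "M \<le> a") auto

text \<open>On \<open>(0, b]\<close> the largest value of \<open>deriv F\<close> is at
  \<open>a\<close>, and to the right of \<open>a\<close> the smallest is at \<open>b\<close>;
  \<open>m\<close> and \<open>M\<close> lie in these two regions.\<close>

lemma sigma_between: "deriv F b < \<sigma>" "\<sigma> < deriv F a"
proof -
  have "deriv F b \<le> deriv F M"
    using deriv_less_right[of b M] deriv_less_mid[of M b] a_less_M by (cases M b rule: linorder_cases) auto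
  then show "deriv F b < \<sigma>" using deriv_less_sigma by simp
  have "deriv F m \<le> deriv F a"
    using deriv_less_left[of m a] deriv_less_mid[of a m] m_less_b m_pos by (cases m a rule: linorder_cases) auto
  then show "\<sigma> < deriv F a" using sigma_less by simp
qed

lemma sigma_range: "\<sigma> \<in> range\<sigma>"
  using sigma_between by simp

text \<open>The signs of \<open>deriv F - \<sigma>\<close> at \<open>m\<close> and \<open>M\<close>
  leave two intervals for each; \<open>m < b\<close> and \<open>a < M\<close> discard the outer
  ones.\<close>

lemma ends_location: "\<alpha> \<sigma> < m" "m < \<zeta> \<sigma>" "\<zeta> \<sigma> < M" "M < \<beta> \<sigma>"
proof -
  note c = crit_alpha[OF sigma_range] crit_beta[OF sigma_range] crit_zeta[OF sigma_range]
    and s = deriv_sign[OF sigma_range] and e = sigma_less deriv_less_sigma m_less_b a_less_M m_pos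
  show "\<alpha> \<sigma> < m" using s(1)[of m] c e by (cases m "\<alpha> \<sigma>" rule: linorder_cases) auto
  show "m < \<zeta> \<sigma>" using s(3)[of m] c e by (cases m "\<zeta> \<sigma>" rule: linorder_cases) auto
  show "\<zeta> \<sigma> < M" using s(2)[of M] c e by (cases M "\<zeta> \<sigma>" rule: linorder_cases) auto
  show "M < \<beta> \<sigma>" using s(4)[of M] c e by (cases M "\<beta> \<sigma>" rule: linorder_cases) auto
qed

text \<open>Every simple solution turns out to have an admissible pair, so an arbitrary competitor
  can be located through its pair.\<close>

lemma pair: "simple_solution_pair F a b \<epsilon> r z (\<sigma>, c)"
proof -
  have "Phi F \<sigma> (\<alpha> \<sigma>) < c" "c < Phi F \<sigma> (\<zeta> \<sigma>)"
    using Phi_monotone(2)[OF sigma_range, of "\<alpha> \<sigma>" m] Phi_monotone(2)[OF sigma_range, of m "\<zeta> \<sigma>"] ends_location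
    by (auto simp: c_def)
  moreover have "Phi F \<sigma> (\<beta> \<sigma>) < c"
    using Phi_monotone(3)[OF sigma_range, of M "\<beta> \<sigma>"] ends_location Phi_ends by auto
  ultimately show ?thesis
    using simple first_integral sigma_between
    by (auto simp: simple_solution_pair_def admissible_def)
qed

end

section \<open>The normalised double well \<open>G\<close>\<close>

context double_well
begin

definition G :: "real \<Rightarrow> real" where
  "G z = Phi F \<sigma>\<^sub>0 z - b\<^sub>0"

definition J :: "real \<Rightarrow> (real \<Rightarrow> real) \<Rightarrow> real" where
  "J \<epsilon> z = integral (ival \<epsilon>) (\<lambda>t. Q (\<epsilon> * dz \<epsilon> z t) / \<epsilon>\<^sup>2 + G (z t))"

lemma G_wells: "G \<alpha>\<^sub>0 = 0" "G \<beta>\<^sub>0 = 0"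
  using sigma0 by (simp_all add: G_def)

lemma G_monotone:
  shows "0 < x \<Longrightarrow> x < y \<Longrightarrow> y \<le> \<alpha>\<^sub>0 \<Longrightarrow> G y < G x"
    and "\<alpha>\<^sub>0 \<le> x \<Longrightarrow> x < y \<Longrightarrow> y \<le> \<zeta>\<^sub>0 \<Longrightarrow> G x < G y"
    and "\<zeta>\<^sub>0 \<le> x \<Longrightarrow> x < y \<Longrightarrow> y \<le> \<beta>\<^sub>0 \<Longrightarrow> G y < G x"
    and "\<beta>\<^sub>0 \<le> x \<Longrightarrow> x < y \<Longrightarrow> G x < G y"
  using Phi_monotone[OF sigma0_range, of x y] unfolding G_def alpha0_def[symmetric] beta0_def[symmetric]
  by simp_all

lemma G_nonneg: "0 < z \<Longrightarrow> 0 \<le> G z"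
  using Phi_alpha_le[OF sigma0_range, of z] Phi_beta_le[OF sigma0_range, of z] sigma0(3)
  unfolding G_def alpha0_def[symmetric] beta0_def[symmetric] by (cases "z \<le> \<zeta>\<^sub>0") auto

lemma continuous_G: "continuous_on {0<..} G"
  unfolding G_def by (intro continuous_intros continuous_Phi)

text \<open>\<open>G\<close> is monotone on four branches, so away from the wells it is at least its
  smallest value at the four points at distance \<open>d\<close> from them.\<close>

lemma well_separation:
  assumes "0 < e"
  obtains \<eta> where "0 < \<eta>" "\<And>z. 0 < z \<Longrightarrow> G z < \<eta> \<Longrightarrow> \<bar>z - \<alpha>\<^sub>0\<bar> < e \<or> \<bar>z - \<beta>\<^sub>0\<bar> < e"
proof -
  \<comment> \<open>This choice keeps \<open>\<alpha>\<^sub>0 - d\<close> positive and the two inner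
    points on their own sides of \<open>\<zeta>\<^sub>0\<close>.\<close>
  define d where "d = min e (min (\<alpha>\<^sub>0 / 2) (min ((\<zeta>\<^sub>0 - \<alpha>\<^sub>0) / 2) ((\<beta>\<^sub>0 - \<zeta>\<^sub>0) / 2)))"
  have d: "0 < d" "d \<le> e" "d < \<alpha>\<^sub>0" "\<alpha>\<^sub>0 + d \<le> \<zeta>\<^sub>0" "\<zeta>\<^sub>0 \<le> \<beta>\<^sub>0 - d"
    using assms crit0(1-3) unfolding d_def by (auto simp: min_def field_simps)
  define \<eta> where "\<eta> = min (min (G (\<alpha>\<^sub>0 - d)) (G (\<alpha>\<^sub>0 + d))) (min (G (\<beta>\<^sub>0 - d)) (G (\<beta>\<^sub>0 + d)))"
  show ?thesis
  proof (rule that)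
    show "0 < \<eta>"
      using G_monotone(1)[of "\<alpha>\<^sub>0 - d" \<alpha>\<^sub>0] G_monotone(2)[of \<alpha>\<^sub>0 "\<alpha>\<^sub>0 + d"]
        G_monotone(3)[of "\<beta>\<^sub>0 - d" \<beta>\<^sub>0] G_monotone(4)[of \<beta>\<^sub>0 "\<beta>\<^sub>0 + d"] d G_wells
      unfolding \<eta>_def by auto
    fix z :: real assume z: "0 < z" "G z < \<eta>"
    have "\<not> z \<le> \<alpha>\<^sub>0 - d"
      using G_monotone(1)[of z "\<alpha>\<^sub>0 - d"] z d unfolding \<eta>_def by (cases "z = \<alpha>\<^sub>0 - d") auto
    moreover have "\<not> (\<alpha>\<^sub>0 + d \<le> z \<and> z \<le> \<zeta>\<^sub>0)"
      using G_monotone(2)[of "\<alpha>\<^sub>0 + d" z] z d unfolding \<eta>_def by (cases "z = \<alpha>\<^sub>0 + d") auto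
    moreover have "\<not> (\<zeta>\<^sub>0 \<le> z \<and> z \<le> \<beta>\<^sub>0 - d)"
      using G_monotone(3)[of z "\<beta>\<^sub>0 - d"] z d unfolding \<eta>_def by (cases "z = \<beta>\<^sub>0 - d") auto
    moreover have "\<not> \<beta>\<^sub>0 + d \<le> z"
      using G_monotone(4)[of "\<beta>\<^sub>0 + d" z] z d unfolding \<eta>_def by (cases "z = \<beta>\<^sub>0 + d") auto
    ultimately show "\<bar>z - \<alpha>\<^sub>0\<bar> < e \<or> \<bar>z - \<beta>\<^sub>0\<bar> < e"
      using d by linarith
  qed
qed

text \<open>Past \<open>y\<close> the slope of \<open>G\<close> is at least its positive value at
  \<open>y\<close>; the constant handed over is the reciprocal of that slope. The bound controls
  \<open>z\<close> where the energy density is not small.\<close>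

lemma G_growth:
  obtains k y where "0 < k" "0 < y" "\<And>z. 0 < z \<Longrightarrow> z \<le> y + k * G z"
proof -
  define y where "y = \<beta>\<^sub>0 + 1"
  define k where "k = deriv F y - \<sigma>\<^sub>0"
  have y: "b < y" "0 < y" "\<beta>\<^sub>0 < y" and k: "0 < k"
    using crit0 a_pos a_less_b deriv_less_right[of \<beta>\<^sub>0 y] unfolding y_def k_def by auto
  have "z \<le> y + (1 / k) * G z" if "0 < z" for z
  proof (cases "z \<le> y")
    case True
    then show ?thesis using G_nonneg[OF that] k by (simp add: add_increasing2)
  next
    case False
    then obtain \<xi> where \<xi>: "y < \<xi>" "Phi F \<sigma>\<^sub>0 z - Phi F \<sigma>\<^sub>0 y = (z - y) * (deriv F \<xi> - \<sigma>\<^sub>0)"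
      using MVT2[of y z "Phi F \<sigma>\<^sub>0" "\<lambda>x. deriv F x - \<sigma>\<^sub>0"] DERIV_Phi y by fastforce
    have "k * (z - y) \<le> (z - y) * (deriv F \<xi> - \<sigma>\<^sub>0)"
      using deriv_less_right[of y \<xi>] y \<xi> False unfolding k_def by (simp add: mult.commute)
    also have "\<dots> \<le> G z"
      using \<xi>(2) G_nonneg[OF y(2)] unfolding G_def by simp
    finally show ?thesis using k by (simp add: field_simps)
  qed
  then show ?thesis using that[of "1 / k" y] k y by simp
qed

end

section \<open>Upper bound for \<open>J\<close> and visits to both wells\<close>

context simple_sol
begin

abbreviation "h t \<equiv> Q (\<epsilon> * z' t) / \<epsilon>\<^sup>2 + G (z t)"

lemma has_integral_const_ival: "((\<lambda>t. k) has_integral (2 * k / \<epsilon>)) (ival \<epsilon>)" for k :: real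
  using has_integral_const_real[of k "-L" L] eps by (simp add: ival_def)

lemma z_integrable: "z integrable_on ival \<epsilon>"
  unfolding ival_def using z_cont by (intro integrable_continuous_real) (simp add: ival_def)

lemma z'_integral: "integral (ival \<epsilon>) z' = M - m" and z'_integrable: "z' integrable_on ival \<epsilon>"
proof -
  have "(z' has_integral (M - m)) (ival \<epsilon>)"
    unfolding ival_def using L_pos z_vderiv
    by (intro fundamental_theorem_of_calculus) (auto simp: ival_def)
  then show "integral (ival \<epsilon>) z' = M - m" "z' integrable_on ival \<epsilon>"
    by (auto intro: integral_unique)
qed

lemma h_integrable: "h integrable_on ival \<epsilon>"
proof -
  have Q: "continuous_on UNIV Q"
    unfolding Q_def by (intro continuous_intros)
  have "continuous_on (ival \<epsilon>) (\<lambda>t. Q (\<epsilon> * z' t))"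
    by (rule continuous_on_compose2[OF Q]) (auto intro!: continuous_intros z'_cont)
  moreover have "continuous_on (ival \<epsilon>) (\<lambda>t. G (z t))"
    by (rule continuous_on_compose2[OF continuous_G z_cont]) (use z_pos in auto)
  ultimately have "continuous_on (ival \<epsilon>) h"
    using eps by (intro continuous_intros) auto
  then show ?thesis
    unfolding ival_def by (rule integrable_continuous_real)
qed

lemma affine_h:
  "(\<lambda>t. p + q * h t) integrable_on ival \<epsilon>"
  "integral (ival \<epsilon>) (\<lambda>t. p + q * h t) = 2 * p / \<epsilon> + q * J \<epsilon> z"
proof -
  have "((\<lambda>t. p + q * h t) has_integral (2 * p / \<epsilon> + q * J \<epsilon> z)) (ival \<epsilon>)"
    unfolding J_def
    by (intro has_integral_add has_integral_const_ival has_integral_mult_right integrable_integral h_integrable)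
  then show "(\<lambda>t. p + q * h t) integrable_on ival \<epsilon>"
    "integral (ival \<epsilon>) (\<lambda>t. p + q * h t) = 2 * p / \<epsilon> + q * J \<epsilon> z"
    by (auto intro: integral_unique)
qed

text \<open>The difference between the density of the energy and that of \<open>J\<close> is
  \<open>\<sigma>\<^sub>0 * z + b\<^sub>0\<close>, whose integral depends only on the prescribed
  mass.\<close>

lemma energy_J: "energy F \<epsilon> z = 2 * r * \<sigma>\<^sub>0 + 2 * b\<^sub>0 + \<epsilon> * J \<epsilon> z"
proof -
  have "((\<lambda>t. h t + (\<sigma>\<^sub>0 * z t + b\<^sub>0)) has_integral (J \<epsilon> z + (\<sigma>\<^sub>0 * (2 * r / \<epsilon>) + 2 * b\<^sub>0 / \<epsilon>))) (ival \<epsilon>)"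
    unfolding J_def z_integral[symmetric]
    by (intro has_integral_add has_integral_const_ival has_integral_mult_right integrable_integral
        h_integrable z_integrable)
  moreover have "h t + (\<sigma>\<^sub>0 * z t + b\<^sub>0) = Q (\<epsilon> * z' t) / \<epsilon>\<^sup>2 + F (z t)" for t
    by (simp add: G_def Phi_def)
  ultimately have "integral (ival \<epsilon>) (\<lambda>t. Q (\<epsilon> * z' t) / \<epsilon>\<^sup>2 + F (z t))
      = J \<epsilon> z + (\<sigma>\<^sub>0 * (2 * r / \<epsilon>) + 2 * b\<^sub>0 / \<epsilon>)"
    by (simp add: integral_unique)
  then show ?thesis
    unfolding energy_def using eps by (simp add: field_simps)
qed

text \<open>The first integral gives \<open>G (z t) = P + (\<sigma> - \<sigma>\<^sub>0) * z t + (c -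
  b\<^sub>0)\<close>. \<open>Q_plus_P_le\<close> absorbs \<open>Q\<close> and \<open>P\<close> into
  \<open>z'\<close>; the remainder integrates to the deviation of the pair from the Maxwell point,
  amplified by \<open>1 / \<epsilon>\<close>.\<close>

lemma J_upper:
  assumes "\<And>t. t \<in> ival \<epsilon> \<Longrightarrow> Phi F \<sigma> (z t) - c \<le> B"
  shows "J \<epsilon> z \<le> (1 + 2 * B) * (M - m) + 2 * (r * (\<sigma> - \<sigma>\<^sub>0) + (c - b\<^sub>0)) / \<epsilon>"
proof -
  let ?g = "\<lambda>t. (1 + 2 * B) * z' t + ((\<sigma> - \<sigma>\<^sub>0) * z t + (c - b\<^sub>0))"
  have "(?g has_integral ((1 + 2 * B) * (M - m) + ((\<sigma> - \<sigma>\<^sub>0) * (2 * r / \<epsilon>) + 2 * (c - b\<^sub>0) / \<epsilon>))) (ival \<epsilon>)"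
    unfolding z_integral[symmetric] z'_integral[symmetric]
    by (intro has_integral_add has_integral_const_ival has_integral_mult_right integrable_integral
        z_integrable z'_integrable)
  then have int: "?g integrable_on ival \<epsilon>" and eq: "integral (ival \<epsilon>) ?g =
      (1 + 2 * B) * (M - m) + ((\<sigma> - \<sigma>\<^sub>0) * (2 * r / \<epsilon>) + 2 * (c - b\<^sub>0) / \<epsilon>)"
    by (auto intro: integral_unique)
  have "J \<epsilon> z \<le> integral (ival \<epsilon>) ?g"
    unfolding J_def
  proof (rule integral_le[OF h_integrable int])
    fix t assume t: "t \<in> ival \<epsilon>"
    have "G (z t) = P \<epsilon> (z' t) + ((\<sigma> - \<sigma>\<^sub>0) * z t + (c - b\<^sub>0))"
      using first_integral[OF t] by (simp add: G_def Phi_def algebra_simps)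
    moreover have "Q (\<epsilon> * z' t) / \<epsilon>\<^sup>2 + P \<epsilon> (z' t) \<le> z' t * (1 + 2 * P \<epsilon> (z' t))"
      using eps z'_nonneg[OF t] by (intro Q_plus_P_le) auto
    moreover have "z' t * (1 + 2 * P \<epsilon> (z' t)) \<le> z' t * (1 + 2 * B)"
      using assms[OF t] first_integral[OF t] z'_nonneg[OF t] by (intro mult_left_mono) auto
    ultimately show "h t \<le> ?g t" by (simp add: mult.commute)
  qed
  also have "\<dots> = (1 + 2 * B) * (M - m) + 2 * (r * (\<sigma> - \<sigma>\<^sub>0) + (c - b\<^sub>0)) / \<epsilon>"
    unfolding eq using eps by (simp add: field_simps)
  finally show ?thesis .
qed

lemma pair_unique: "simple_solution_pair F a b \<epsilon> r z (\<sigma>, d) \<Longrightarrow> d = c"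
  using first_integral[OF ival_ends(1)] ival_ends(1) by (auto simp: simple_solution_pair_def)

text \<open>Where \<open>h < \<eta>\<close>, \<open>z\<close> is near a well and \<open>P\<close> is
  small. If one well were never visited there, \<open>z\<close> would stay near the other, and the
  remaining points could shift the integral of \<open>z\<close> by at most a multiple of
  \<open>J\<close>, too little for the mean to be \<open>r\<close>.\<close>

lemma near_wells:
  assumes \<eta>: "0 < \<eta>" "\<eta> \<le> e" "\<And>x. 0 < x \<Longrightarrow> G x < \<eta> \<Longrightarrow> \<bar>x - \<alpha>\<^sub>0\<bar> < e' \<or> \<bar>x - \<beta>\<^sub>0\<bar> < e'"
    and e': "e' \<le> e" "e' \<le> \<delta> / 2"
    and k: "0 < k" "0 < y" "\<And>x. 0 < x \<Longrightarrow> x \<le> y + k * G x"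
    and J: "J \<epsilon> z \<le> B"
    and r: "0 < \<delta>" "\<alpha>\<^sub>0 + \<delta> \<le> r" "r \<le> \<beta>\<^sub>0 - \<delta>"
    and small: "\<epsilon> * ((y / \<eta> + k) * B) < \<delta>" "\<epsilon> * (\<beta>\<^sub>0 / \<eta> * B) < \<delta>"
  shows "\<exists>t\<in>ival \<epsilon>. \<bar>z t - \<alpha>\<^sub>0\<bar> < e \<and> P \<epsilon> (z' t) < e"
    and "\<exists>t\<in>ival \<epsilon>. \<bar>z t - \<beta>\<^sub>0\<bar> < e \<and> P \<epsilon> (z' t) < e"
proof -
  have good: "P \<epsilon> (z' t) < e \<and> (\<bar>z t - \<alpha>\<^sub>0\<bar> < e' \<or> \<bar>z t - \<beta>\<^sub>0\<bar> < e')"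
    if "t \<in> ival \<epsilon>" "h t < \<eta>" for t
  proof -
    have "0 \<le> Q (\<epsilon> * z' t) / \<epsilon>\<^sup>2" "0 \<le> G (z t)" "P \<epsilon> (z' t) \<le> Q (\<epsilon> * z' t) / \<epsilon>\<^sup>2"
      using G_nonneg[OF z_pos[OF that(1)]] eps P_le_Q[of \<epsilon>] by (auto simp: Q_nonneg)
    with that \<eta>(2) \<eta>(3)[OF z_pos[OF that(1)]] show ?thesis by auto
  qed
  have G_le: "G (z t) \<le> h t" for t
    using eps by (simp add: Q_nonneg)
  have dens: "0 \<le> h t" if "t \<in> ival \<epsilon>" for t
    using G_nonneg[OF z_pos[OF that]] eps by (simp add: Q_nonneg)
  show "\<exists>t\<in>ival \<epsilon>. \<bar>z t - \<beta>\<^sub>0\<bar> < e \<and> P \<epsilon> (z' t) < e"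
  proof (rule ccontr)
    assume no: "\<not> ?thesis"
    \<comment> \<open>The constant dominates \<open>z\<close> where \<open>h < \<eta>\<close>;
      elsewhere \<open>y <= y / \<eta> * h\<close>, and the multiple of \<open>h\<close> dominates
      \<open>y + k * G\<close>.\<close>
    have "integral (ival \<epsilon>) z \<le> integral (ival \<epsilon>) (\<lambda>t. (\<alpha>\<^sub>0 + \<delta> / 2) + (y / \<eta> + k) * h t)"
    proof (rule integral_le[OF z_integrable affine_h(1)])
      fix t assume t: "t \<in> ival \<epsilon>"
      show "z t \<le> (\<alpha>\<^sub>0 + \<delta> / 2) + (y / \<eta> + k) * h t"
      proof (cases "h t < \<eta>")
        case True
        then have "z t \<le> \<alpha>\<^sub>0 + \<delta> / 2" using good[OF t] no t e' by force
        moreover have "0 \<le> (y / \<eta> + k) * h t" using dens[OF t] k \<eta> by simp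
        ultimately show ?thesis by simp
      next
        case False
        have "y * \<eta> \<le> y * h t" using False k by simp
        then have "y \<le> y / \<eta> * h t" using \<eta> by (simp add: field_simps)
        moreover have "k * G (z t) \<le> k * h t" using G_le k by (intro mult_left_mono) auto
        moreover have "0 \<le> \<alpha>\<^sub>0 + \<delta> / 2" using crit0(1-3) r by simp
        ultimately show ?thesis using k(3)[OF z_pos[OF t]] unfolding distrib_right by linarith
      qed
    qed
    also have "\<dots> \<le> 2 * (\<alpha>\<^sub>0 + \<delta> / 2) / \<epsilon> + (y / \<eta> + k) * B"
      unfolding affine_h(2) using J k \<eta> by (intro add_left_mono mult_left_mono) auto
    \<comment> \<open>By \<open>small\<close> the right side is below
      \<open>2 * \<alpha>\<^sub>0 + 2 * \<delta>\<close>, against the lower bound on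
      \<open>r\<close>.\<close>
    finally have "2 * r \<le> 2 * (\<alpha>\<^sub>0 + \<delta> / 2) + \<epsilon> * ((y / \<eta> + k) * B)"
      unfolding z_integral using eps by (simp add: field_simps)
    then show False using small r by simp
  qed
  show "\<exists>t\<in>ival \<epsilon>. \<bar>z t - \<alpha>\<^sub>0\<bar> < e \<and> P \<epsilon> (z' t) < e"
  proof (rule ccontr)
    assume no: "\<not> ?thesis"
    \<comment> \<open>Where \<open>h >= \<eta>\<close> the comparison function is negative, so
      positivity of \<open>z\<close> suffices there.\<close>
    have "integral (ival \<epsilon>) (\<lambda>t. (\<beta>\<^sub>0 - \<delta> / 2) + (- (\<beta>\<^sub>0 / \<eta>)) * h t) \<le> integral (ival \<epsilon>) z"
    proof (rule integral_le[OF affine_h(1) z_integrable])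
      fix t assume t: "t \<in> ival \<epsilon>"
      show "(\<beta>\<^sub>0 - \<delta> / 2) + (- (\<beta>\<^sub>0 / \<eta>)) * h t \<le> z t"
      proof (cases "h t < \<eta>")
        case True
        then have "\<beta>\<^sub>0 - \<delta> / 2 \<le> z t" using good[OF t] no t e' by force
        moreover have "0 \<le> \<beta>\<^sub>0 / \<eta> * h t" using dens[OF t] crit0(1-3) \<eta> by simp
        ultimately show ?thesis by simp
      next
        case False
        have "\<beta>\<^sub>0 * \<eta> \<le> \<beta>\<^sub>0 * h t" using False crit0(1-3) by simp
        then have "\<beta>\<^sub>0 \<le> \<beta>\<^sub>0 / \<eta> * h t" using \<eta> by (simp add: field_simps)
        then show ?thesis using z_pos[OF t] crit0(1-3) r by simp
      qed
    qed
    moreover have "2 * (\<beta>\<^sub>0 - \<delta> / 2) / \<epsilon> - \<beta>\<^sub>0 / \<eta> * B \<le>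
        integral (ival \<epsilon>) (\<lambda>t. (\<beta>\<^sub>0 - \<delta> / 2) + (- (\<beta>\<^sub>0 / \<eta>)) * h t)"
      unfolding affine_h(2) using J crit0(1-3) \<eta> mult_left_mono[OF J, of "\<beta>\<^sub>0 / \<eta>"] by simp
    ultimately have "\<epsilon> * (2 * (\<beta>\<^sub>0 - \<delta> / 2) / \<epsilon> - \<beta>\<^sub>0 / \<eta> * B) \<le> \<epsilon> * (2 * r / \<epsilon>)"
      unfolding z_integral using eps by (intro mult_left_mono) auto
    then have "2 * (\<beta>\<^sub>0 - \<delta> / 2) - \<epsilon> * (\<beta>\<^sub>0 / \<eta> * B) \<le> 2 * r"
      using eps by (simp add: right_diff_distrib[of \<epsilon> "_ / \<epsilon>"])
    then show False using small r by simp
  qed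
qed

end

section \<open>Estimates uniform in small \<epsilon>\<close>

context double_well
begin

lemma maxwell_J_bounded:
  assumes \<delta>: "0 < \<delta>" and N: "maxwell_neighbourhood F a b \<delta> \<epsilon>1 N"
  obtains B \<epsilon>3 where "0 < \<epsilon>3" "0 \<le> B"
    "\<And>\<epsilon> r z. 0 < \<epsilon> \<Longrightarrow> \<epsilon> < \<epsilon>3 \<Longrightarrow> r \<in> R_set F a b \<delta> \<Longrightarrow> maxwell_solution F a b N \<epsilon> r z \<Longrightarrow> J \<epsilon> z \<le> B"
proof -
  obtain C K \<epsilon>2 where C: "0 < C" "0 < \<epsilon>2" "0 < \<epsilon>1"
    and K: "\<And>\<epsilon> r z \<Delta>. \<epsilon> \<in> {0<..<min \<epsilon>1 \<epsilon>2} \<Longrightarrow> r \<in> R_set F a b \<delta> \<Longrightarrow> \<Delta> \<in> N \<Longrightarrow>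
      simple_solution_pair F a b \<epsilon> r z \<Delta> \<Longrightarrow> norm (\<Delta> - maxwell_point F a b) \<le> K * exp (- C / \<epsilon>)"
    using N unfolding maxwell_neighbourhood_def by blast
  \<comment> \<open>The inequality \<open>exp (- C / \<epsilon>) <= \<epsilon> / C\<close> turns the
    exponential rate into the linear bound \<open>K' * \<epsilon>\<close>, which offsets the factor
    \<open>1 / \<epsilon>\<close> of \<open>J_upper\<close>.\<close>
  define K' where "K' = \<bar>K\<bar> / C"
  have K': "0 \<le> K'" using C by (simp add: K'_def)
  define a1 b1 where "a1 = \<alpha>\<^sub>0 / 2" and "b1 = \<beta>\<^sub>0 + 1"
  have ab1: "0 < a1" "a1 < \<alpha>\<^sub>0" "\<beta>\<^sub>0 < b1" "0 < b1"
    using crit0 a_pos a_less_b by (auto simp: a1_def b1_def)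
  \<comment> \<open>A multiplier within \<rho> of \<open>\<sigma>\<^sub>0\<close> lies strictly
    between \<open>deriv F a1\<close> and \<open>deriv F b1\<close>; this confines the solution to
    the fixed interval \<open>[a1, b1]\<close>.\<close>
  define \<rho> where "\<rho> = min (\<sigma>\<^sub>0 - deriv F a1) (deriv F b1 - \<sigma>\<^sub>0)"
  have \<rho>: "0 < \<rho>"
    using deriv_less_left[of a1 \<alpha>\<^sub>0] deriv_less_right[of \<beta>\<^sub>0 b1] crit0 ab1 by (simp add: \<rho>_def)
  have "continuous_on {a1..b1} F"
    by (rule continuous_on_subset[OF continuous_F]) (use ab1 in auto)
  then obtain Fmax where Fmax: "\<And>x. x \<in> {a1..b1} \<Longrightarrow> \<bar>F x\<bar> \<le> Fmax"
    by (rule bounded_on_Icc) blast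
  define B\<^sub>P where "B\<^sub>P = Fmax + (\<bar>\<sigma>\<^sub>0\<bar> + \<rho>) * b1 + (\<bar>b\<^sub>0\<bar> + \<rho>)"
  define B where "B = (1 + 2 * B\<^sub>P) * b1 + 2 * ((\<beta>\<^sub>0 + 1) * K')"
  \<comment> \<open>The last entry guarantees \<open>K' * \<epsilon> < \<rho>\<close>; adding 1
    avoids division by zero.\<close>
  define \<epsilon>3 where "\<epsilon>3 = min (min \<epsilon>1 \<epsilon>2) (\<rho> / (K' + 1))"
  have B\<^sub>P: "0 \<le> B\<^sub>P"
    using Fmax[of a1] crit0(1-3) ab1 \<rho> unfolding B\<^sub>P_def by auto
  show ?thesis
  proof (rule that)
    show "0 < \<epsilon>3" using C \<rho> K' by (simp add: \<epsilon>3_def)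
    show "0 \<le> B" using B\<^sub>P ab1 K' crit0(1-3) by (simp add: B_def)
    fix \<epsilon> r z
    assume ep: "0 < \<epsilon>" "\<epsilon> < \<epsilon>3" and r: "r \<in> R_set F a b \<delta>" and "maxwell_solution F a b N \<epsilon> r z"
    then obtain \<sigma> d where d: "(\<sigma>, d) \<in> N" "simple_solution_pair F a b \<epsilon> r z (\<sigma>, d)"
      unfolding maxwell_solution_def by auto
    interpret simple_sol F a b \<epsilon> r z \<sigma>
      using d ep by unfold_locales (auto simp: simple_solution_pair_def)
    have rng: "\<epsilon> \<in> {0<..<min \<epsilon>1 \<epsilon>2}" using ep by (simp add: \<epsilon>3_def)
    have dc: "d = c" using pair_unique[OF d(2)] .
    have "exp (- C / \<epsilon>) \<le> \<epsilon> / C"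
    proof -
      have "C / \<epsilon> \<le> exp (C / \<epsilon>)" using exp_ge_add_one_self[of "C / \<epsilon>"] by linarith
      then have "1 / exp (C / \<epsilon>) \<le> 1 / (C / \<epsilon>)"
        using C ep by (intro divide_left_mono) auto
      then show ?thesis by (simp add: exp_minus inverse_eq_divide)
    qed
    note exp_le = this
    have "norm ((\<sigma>, c) - maxwell_point F a b) \<le> K * exp (- C / \<epsilon>)"
      by (rule K[OF rng r d[unfolded dc]])
    also have "\<dots> \<le> \<bar>K\<bar> * exp (- C / \<epsilon>)"
      by (intro mult_right_mono) auto
    also have "\<dots> \<le> \<bar>K\<bar> * (\<epsilon> / C)"
      by (intro mult_left_mono exp_le) auto
    also have "\<dots> = K' * \<epsilon>"
      by (simp add: K'_def)
    finally have "norm ((\<sigma>, c) - maxwell_point F a b) \<le> K' * \<epsilon>" .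
    then have close: "\<bar>\<sigma> - \<sigma>\<^sub>0\<bar> \<le> K' * \<epsilon>" "\<bar>c - b\<^sub>0\<bar> \<le> K' * \<epsilon>"
      using norm_fst_le[of "\<sigma> - \<sigma>\<^sub>0" "c - b\<^sub>0"] norm_snd_le[of "c - b\<^sub>0" "\<sigma> - \<sigma>\<^sub>0"]
      by (auto simp: maxwell_point_def)
    have "(K' + 1) * \<epsilon> < \<rho>"
      using ep K' unfolding \<epsilon>3_def by (simp add: field_simps)
    then have "K' * \<epsilon> < \<rho>" using ep by (simp add: algebra_simps)
    with close have \<rho>': "\<bar>\<sigma> - \<sigma>\<^sub>0\<bar> < \<rho>" "\<bar>c - b\<^sub>0\<bar> < \<rho>" by auto
    then have "deriv F a1 < \<sigma>" "\<sigma> < deriv F b1" by (auto simp: \<rho>_def)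
    \<comment> \<open>If \<open>m <= a1\<close>, monotonicity on the left branch would give
      \<open>deriv F m <= deriv F a1 < \<sigma>\<close>, against \<open>sigma_less\<close>; the
      bound on \<open>M\<close> is symmetric.\<close>
    then have mM: "a1 < m" "M < b1"
      using deriv_less_left[of m a1] deriv_less_right[of b1 M] sigma_less deriv_less_sigma
        m_pos ab1 crit0(4,5) by (cases m a1 rule: linorder_cases; cases M b1 rule: linorder_cases; force)+
    have "J \<epsilon> z \<le> (1 + 2 * B\<^sub>P) * (M - m) + 2 * (r * (\<sigma> - \<sigma>\<^sub>0) + (c - b\<^sub>0)) / \<epsilon>"
    proof (rule J_upper)
      fix t assume t: "t \<in> ival \<epsilon>"
      then have z: "a1 \<le> z t" "z t \<le> b1" using z_between[OF t] mM by auto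
      have "- \<sigma> * z t \<le> (\<bar>\<sigma>\<^sub>0\<bar> + \<rho>) * b1"
        using \<rho>' z ab1 \<rho> by (intro mult_mono) auto
      then show "Phi F \<sigma> (z t) - c \<le> B\<^sub>P"
        using Fmax[of "z t"] z \<rho>' unfolding Phi_def B\<^sub>P_def by auto
    qed
    also have "\<dots> \<le> B"
      unfolding B_def
    proof (rule add_mono)
      show "(1 + 2 * B\<^sub>P) * (M - m) \<le> (1 + 2 * B\<^sub>P) * b1"
        using B\<^sub>P mM m_pos by (intro mult_left_mono) auto
      have "0 < r" "r < \<beta>\<^sub>0" using r \<delta> crit0(1) by (auto simp: R_set_def)
      then have "r * (\<sigma> - \<sigma>\<^sub>0) \<le> \<beta>\<^sub>0 * (K' * \<epsilon>)"
        using close ep K' by (intro order_trans[OF mult_left_mono mult_right_mono]) auto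
      then have "2 * (r * (\<sigma> - \<sigma>\<^sub>0) + (c - b\<^sub>0)) \<le> 2 * ((\<beta>\<^sub>0 + 1) * K') * \<epsilon>"
        using close by (simp add: algebra_simps)
      then show "2 * (r * (\<sigma> - \<sigma>\<^sub>0) + (c - b\<^sub>0)) / \<epsilon> \<le> 2 * ((\<beta>\<^sub>0 + 1) * K')"
        using ep by (simp add: divide_le_eq)
    qed
    finally show "J \<epsilon> z \<le> B" .
  qed
qed

text \<open>The pair \<open>(\<sigma>, c)\<close> of a first integral is a continuous function of two points
  \<open>x \<noteq> y\<close> on the trajectory and the values \<open>p\<close>, \<open>q\<close> of \<open>P\<close> there.\<close>

lemma pair_near_maxwell_point:
  assumes "open U" "maxwell_point F a b \<in> U"
  obtains e where "0 < e"
    "\<And>x y p q \<sigma> c. \<bar>x - \<alpha>\<^sub>0\<bar> < e \<Longrightarrow> \<bar>y - \<beta>\<^sub>0\<bar> < e \<Longrightarrow> \<bar>p\<bar> < e \<Longrightarrow> \<bar>q\<bar> < e \<Longrightarrow>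
      p = Phi F \<sigma> x - c \<Longrightarrow> q = Phi F \<sigma> y - c \<Longrightarrow> (\<sigma>, c) \<in> U"
proof -
  define S where "S v = (case v of (x, y, p, q) \<Rightarrow> (F y - F x + p - q) / (y - x))" for v :: "real \<times> real \<times> real \<times> real"
  define \<Psi> where "\<Psi> v = (S v, F (fst v) - S v * fst v - fst (snd (snd v)))" for v
  define v\<^sub>0 where "v\<^sub>0 = (\<alpha>\<^sub>0, \<beta>\<^sub>0, 0 :: real, 0 :: real)"
  have lt: "\<alpha>\<^sub>0 < \<beta>\<^sub>0" using crit0 by linarith
  have F0: "isCont F \<alpha>\<^sub>0" "isCont F \<beta>\<^sub>0"
    using crit0(1) lt by (auto intro!: DERIV_isCont DERIV_F)
  have "isCont (\<lambda>v. F (fst v)) v\<^sub>0" "isCont (\<lambda>v. F (fst (snd v))) v\<^sub>0"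
    by (rule isCont_o2[where g = F]; auto simp: v\<^sub>0_def F0 intro!: continuous_intros)+
  then have "isCont \<Psi> v\<^sub>0"
    using lt unfolding \<Psi>_def S_def case_prod_beta
    by (intro continuous_intros) (auto simp: v\<^sub>0_def)
  moreover have "\<Psi> v\<^sub>0 = maxwell_point F a b"
  proof -
    have "S v\<^sub>0 = \<sigma>\<^sub>0"
      using sigma0(3) lt unfolding S_def v\<^sub>0_def Phi_def by (simp add: field_simps)
    then show ?thesis
      by (simp add: \<Psi>_def v\<^sub>0_def maxwell_point_def Phi_def)
  qed
  ultimately have "\<forall>\<^sub>F v in nhds v\<^sub>0. \<Psi> v \<in> U"
    using assms by (metis isCont_def tendsto_at_iff_tendsto_nhds topological_tendstoD)
  then obtain d where d: "0 < d" "\<And>v. dist v v\<^sub>0 < d \<Longrightarrow> \<Psi> v \<in> U"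
    unfolding eventually_nhds_metric by blast
  \<comment> \<open>One quarter of \<open>d\<close> for each of the four coordinates; the second
    entry keeps \<open>x < y\<close>, so that the quotient in \<open>S\<close> is
    meaningful.\<close>
  define e where "e = min (d / 4) ((\<beta>\<^sub>0 - \<alpha>\<^sub>0) / 2)"
  show ?thesis
  proof (rule that)
    show "0 < e" using d lt by (simp add: e_def)
    fix x y p q \<sigma> c
    assume *: "\<bar>x - \<alpha>\<^sub>0\<bar> < e" "\<bar>y - \<beta>\<^sub>0\<bar> < e" "\<bar>p\<bar> < e" "\<bar>q\<bar> < e"
      and pq: "p = Phi F \<sigma> x - c" "q = Phi F \<sigma> y - c"
    have "dist (x, y, p, q) v\<^sub>0 \<le> \<bar>x - \<alpha>\<^sub>0\<bar> + (\<bar>y - \<beta>\<^sub>0\<bar> + (\<bar>p\<bar> + \<bar>q\<bar>))"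
      unfolding v\<^sub>0_def dist_norm diff_Pair
      by (intro order_trans[OF norm_Pair_le] add_mono) auto
    also have "\<dots> < d" using * unfolding e_def by linarith
    finally have "\<Psi> (x, y, p, q) \<in> U" by (rule d(2))
    moreover have "x < y"
    proof -
      have "e \<le> (\<beta>\<^sub>0 - \<alpha>\<^sub>0) / 2" unfolding e_def by (rule min.cobounded2)
      then show ?thesis using *(1,2) by argo
    qed
    then have "S (x, y, p, q) = \<sigma>"
      unfolding S_def pq Phi_def by (simp add: field_simps)
    then have "\<Psi> (x, y, p, q) = (\<sigma>, c)"
      by (simp add: \<Psi>_def pq(1) Phi_def)
    ultimately show "(\<sigma>, c) \<in> U" by simp
  qed
qed

text \<open>\<open>near_wells\<close> supplies a point near each well with small \<open>P\<close>,
  and by \<open>pair_near_maxwell_point\<close> the first integral at these two points places the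
  pair in \<open>U\<close>. The thresholds depend on \<delta> and \<open>B\<close> but not on
  \<open>r\<close> or the solution.\<close>

lemma low_energy_in_neighbourhood:
  assumes "open U" "maxwell_point F a b \<in> U" "0 < \<delta>" "0 \<le> B"
  obtains \<epsilon>4 where "0 < \<epsilon>4"
    "\<And>\<epsilon> r z \<sigma>. 0 < \<epsilon> \<Longrightarrow> \<epsilon> < \<epsilon>4 \<Longrightarrow> r \<in> R_set F a b \<delta> \<Longrightarrow> simple_solution F \<epsilon> r z \<sigma> \<Longrightarrow> J \<epsilon> z \<le> B \<Longrightarrow>
      \<exists>\<Delta>\<in>U. simple_solution_pair F a b \<epsilon> r z \<Delta>"
proof -
  obtain e where e: "0 < e"
    "\<And>x y p q \<sigma> c. \<bar>x - \<alpha>\<^sub>0\<bar> < e \<Longrightarrow> \<bar>y - \<beta>\<^sub>0\<bar> < e \<Longrightarrow> \<bar>p\<bar> < e \<Longrightarrow> \<bar>q\<bar> < e \<Longrightarrow>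
      p = Phi F \<sigma> x - c \<Longrightarrow> q = Phi F \<sigma> y - c \<Longrightarrow> (\<sigma>, c) \<in> U"
    using pair_near_maxwell_point[OF assms(1,2)] by blast
  define e' where "e' = min e (\<delta> / 2)"
  have e': "0 < e'" "e' \<le> e" "e' \<le> \<delta> / 2" using e assms by (auto simp: e'_def)
  obtain \<eta>' where \<eta>': "0 < \<eta>'" "\<And>x. 0 < x \<Longrightarrow> G x < \<eta>' \<Longrightarrow> \<bar>x - \<alpha>\<^sub>0\<bar> < e' \<or> \<bar>x - \<beta>\<^sub>0\<bar> < e'"
    using well_separation[OF e'(1)] by blast
  \<comment> \<open>The bound by \<open>e\<close> ensures that a density below \<eta> gives
    \<open>P < e\<close>, through \<open>P_le_Q\<close>.\<close>
  define \<eta> where "\<eta> = min \<eta>' e"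
  have \<eta>: "0 < \<eta>" "\<eta> \<le> e" "\<And>x. 0 < x \<Longrightarrow> G x < \<eta> \<Longrightarrow> \<bar>x - \<alpha>\<^sub>0\<bar> < e' \<or> \<bar>x - \<beta>\<^sub>0\<bar> < e'"
    using \<eta>' e by (auto simp: \<eta>_def)
  obtain k y where k: "0 < k" "0 < y" "\<And>x. 0 < x \<Longrightarrow> x \<le> y + k * G x"
    by (rule G_growth) blast
  define A where "A = max ((y / \<eta> + k) * B) (\<beta>\<^sub>0 / \<eta> * B)"
  have A: "0 \<le> A" using k \<eta> assms by (simp add: A_def le_max_iff_disj)
  show ?thesis
  proof (rule that)
    show "0 < \<delta> / (A + 1)" using A assms by simp
    fix \<epsilon> r z \<sigma>
    assume ep: "0 < \<epsilon>" "\<epsilon> < \<delta> / (A + 1)" and r: "r \<in> R_set F a b \<delta>"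
      and z: "simple_solution F \<epsilon> r z \<sigma>" and J: "J \<epsilon> z \<le> B"
    interpret simple_sol F a b \<epsilon> r z \<sigma>
      using z ep by unfold_locales auto
    have "\<epsilon> * A + \<epsilon> < \<delta>" using ep A by (simp add: field_simps)
    then have A': "\<epsilon> * A < \<delta>" using ep by simp
    have "\<epsilon> * ((y / \<eta> + k) * B) \<le> \<epsilon> * A"
      unfolding A_def using ep by (intro mult_left_mono max.cobounded1) simp
    moreover have "\<epsilon> * (\<beta>\<^sub>0 / \<eta> * B) \<le> \<epsilon> * A"
      unfolding A_def using ep by (intro mult_left_mono max.cobounded2) simp
    ultimately have small: "\<epsilon> * ((y / \<eta> + k) * B) < \<delta>" "\<epsilon> * (\<beta>\<^sub>0 / \<eta> * B) < \<delta>" using A' by linarith+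
    have r': "\<alpha>\<^sub>0 + \<delta> \<le> r" "r \<le> \<beta>\<^sub>0 - \<delta>" using r by (auto simp: R_set_def)
    note nw = near_wells[OF \<eta> e'(2,3) k J assms(3) r' small]
    obtain t s where "t \<in> ival \<epsilon>" "\<bar>z t - \<alpha>\<^sub>0\<bar> < e" "P \<epsilon> (dz \<epsilon> z t) < e"
      and "s \<in> ival \<epsilon>" "\<bar>z s - \<beta>\<^sub>0\<bar> < e" "P \<epsilon> (dz \<epsilon> z s) < e"
      using nw by blast
    moreover have "0 \<le> Phi F \<sigma> (z t) - c" if "t \<in> ival \<epsilon>" for t
      using first_integral[OF that] P_nonneg[of \<epsilon> "dz \<epsilon> z t"] ep by simp
    ultimately have "(\<sigma>, c) \<in> U"
      by (intro e(2)[of "z t" "z s" "P \<epsilon> (dz \<epsilon> z t)" "P \<epsilon> (dz \<epsilon> z s)"]) (auto simp: first_integral)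
    then show "\<exists>\<Delta>\<in>U. simple_solution_pair F a b \<epsilon> r z \<Delta>"
      using pair by blast
  qed
qed

end

section \<open>From the stated hypotheses to the energy comparison\<close>

text \<open>The limits are of type \<open>ereal\<close> so that infinite ones are covered. Each
  strict inequality holds eventually along a nontrivial filter and so yields a witness.\<close>

lemma double_wellI:
  fixes F'0 F'inf :: ereal
  assumes "0 < a" and "a < b"
    and smooth: "C_k_on 5 F {0<..}"
    and "\<And>x. x \<in> {0<..<a} \<union> {b<..} \<Longrightarrow> (deriv ^^ 2) F x > 0"
    and "\<And>x. x \<in> {a<..<b} \<Longrightarrow> (deriv ^^ 2) F x < 0"
    and l0: "((\<lambda>x. ereal (deriv F x)) \<longlongrightarrow> F'0) (at_right 0)" "F'0 < ereal (deriv F b)"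
    and linf: "((\<lambda>x. ereal (deriv F x)) \<longlongrightarrow> F'inf) at_top" "F'inf > ereal (deriv F a)"
  shows "double_well F a b"
proof
  have "continuous_on {0<..} ((deriv ^^ 2) F)"
    using smooth unfolding C_k_on_def
    by (intro differentiable_imp_continuous_on) (auto simp: differentiable_on_def intro: differentiable_at_withinI)
  then show "C_k_on 2 F {0<..}"
    using smooth unfolding C_k_on_def by auto
  have "\<forall>\<^sub>F x in at_right 0. x \<in> {0<..<a} \<and> deriv F x < deriv F b"
    using order_tendstoD(2)[OF l0] eventually_at_right_real[OF assms(1)] by eventually_elim auto
  then show "\<exists>x\<in>{0<..<a}. deriv F x < deriv F b"
    using eventually_happens' trivial_limit_at_right_real by blast
  have "\<forall>\<^sub>F x in at_top. x > b \<and> deriv F a < deriv F x"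
    using order_tendstoD(1)[OF linf] eventually_gt_at_top[of b] by eventually_elim auto
  then show "\<exists>x>b. deriv F a < deriv F x"
    using eventually_happens' trivial_limit_at_top_linorder by blast
qed (use assms in auto)

theorem proposition5:
  fixes F :: "real \<Rightarrow> real" and a b \<delta> \<epsilon>1 :: real
    and F'0 F'inf :: ereal and N :: "(real \<times> real) set"
  assumes "0 < a" and "a < b"
    and "C_k_on 5 F {0<..}"
    and "\<And>x. x \<in> {0<..<a} \<union> {b<..} \<Longrightarrow> (deriv ^^ 2) F x > 0"
    and "\<And>x. x \<in> {a<..<b} \<Longrightarrow> (deriv ^^ 2) F x < 0"
    and "((\<lambda>x. ereal (deriv F x)) \<longlongrightarrow> F'0) (at_right 0)" and "F'0 < ereal (deriv F b)"
    and "((\<lambda>x. ereal (deriv F x)) \<longlongrightarrow> F'inf) at_top" and "F'inf > ereal (deriv F a)"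
    and "\<delta> \<in> {0<..<(beta0 F a b - alpha0 F a b) / 2}"
    and "maxwell_neighbourhood F a b \<delta> \<epsilon>1 N"
  shows "\<exists>\<epsilon>\<delta>. 0 < \<epsilon>\<delta> \<and> \<epsilon>\<delta> \<le> \<epsilon>1 \<and>
    (\<forall>\<epsilon>\<in>{0<..<\<epsilon>\<delta>}. \<forall>r\<in>R_set F a b \<delta>. \<forall>z0 z \<sigma>.
       maxwell_solution F a b N \<epsilon> r z0 \<and> simple_solution F \<epsilon> r z \<sigma> \<and>
       (\<exists>t\<in>ival \<epsilon>. z t \<noteq> z0 t)
       \<longrightarrow> energy F \<epsilon> z0 < energy F \<epsilon> z)"
proof -
  interpret double_well F a b
    by (rule double_wellI[OF assms(1-9)])
  have \<delta>: "0 < \<delta>" using assms(10) by simp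
  note N = assms(11)
  note N_parts = N[unfolded maxwell_neighbourhood_def]
  note \<epsilon>1 = N_parts[THEN conjunct1]
    and U = N_parts[THEN conjunct2, THEN conjunct1]
    and ex1 = N_parts[THEN conjunct2, THEN conjunct2, THEN conjunct1]
  obtain B \<epsilon>3 where B: "0 < \<epsilon>3" "0 \<le> B"
    "\<And>\<epsilon> r z. 0 < \<epsilon> \<Longrightarrow> \<epsilon> < \<epsilon>3 \<Longrightarrow> r \<in> R_set F a b \<delta> \<Longrightarrow> maxwell_solution F a b N \<epsilon> r z \<Longrightarrow> J \<epsilon> z \<le> B"
    by (rule maxwell_J_bounded[OF \<delta> N]) blast
  obtain \<epsilon>4 where \<epsilon>4: "0 < \<epsilon>4"
    "\<And>\<epsilon> r z \<sigma>. 0 < \<epsilon> \<Longrightarrow> \<epsilon> < \<epsilon>4 \<Longrightarrow> r \<in> R_set F a b \<delta> \<Longrightarrow> simple_solution F \<epsilon> r z \<sigma> \<Longrightarrow> J \<epsilon> z \<le> B \<Longrightarrow>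
      \<exists>\<Delta>\<in>interior N. simple_solution_pair F a b \<epsilon> r z \<Delta>"
    by (rule low_energy_in_neighbourhood[OF open_interior U \<delta> B(2)]) blast
  \<comment> \<open>\<open>\<epsilon>1\<close> gives access to uniqueness,
    \<open>\<epsilon>3\<close> to the bound on \<open>J\<close> for the Maxwell solution, and
    \<open>\<epsilon>4\<close> to the localisation of low-energy pairs.\<close>
  define \<epsilon>\<delta> where "\<epsilon>\<delta> = min \<epsilon>1 (min \<epsilon>3 \<epsilon>4)"
  have main: "energy F \<epsilon> z0 < energy F \<epsilon> z"
    if eps: "\<epsilon> \<in> {0<..<\<epsilon>\<delta>}" and r: "r \<in> R_set F a b \<delta>" and z0: "maxwell_solution F a b N \<epsilon> r z0"
      and z: "simple_solution F \<epsilon> r z \<sigma>" and ne: "\<exists>t\<in>ival \<epsilon>. z t \<noteq> z0 t" for \<epsilon> r z0 z \<sigma>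
  proof (rule ccontr)
    \<comment> \<open>Equality of the energies is included here, which makes the final inequality
      strict.\<close>
    assume le: "\<not> energy F \<epsilon> z0 < energy F \<epsilon> z"
    obtain \<sigma>' where "simple_solution F \<epsilon> r z0 \<sigma>'"
      using z0 by (auto simp: maxwell_solution_def simple_solution_pair_def)
    then interpret z0: simple_sol F a b \<epsilon> r z0 \<sigma>'
      using eps by unfold_locales auto
    interpret z: simple_sol F a b \<epsilon> r z \<sigma>
      using eps z by unfold_locales auto
    \<comment> \<open>Both solutions have the same mass, so the affine terms in
      \<open>energy_J\<close> agree and the order of the energies passes to
      \<open>J\<close>.\<close>
    have "\<epsilon> * J \<epsilon> z \<le> \<epsilon> * J \<epsilon> z0"
      using le unfolding z0.energy_J z.energy_J by simp
    also have "\<dots> \<le> \<epsilon> * B"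
      using B(3)[OF _ _ r z0] eps by (simp add: \<epsilon>\<delta>_def)
    finally have "J \<epsilon> z \<le> B" using eps by simp
    \<comment> \<open>The competitor's pair lies in \<open>interior N\<close>, hence in
      \<open>N\<close>; uniqueness then identifies it with \<open>z0\<close> on the whole
      interval.\<close>
    then have "maxwell_solution F a b N \<epsilon> r z"
      using \<epsilon>4(2)[OF _ _ r z] eps interior_subset unfolding maxwell_solution_def \<epsilon>\<delta>_def by fastforce
    moreover have "\<epsilon> \<in> {0<..<\<epsilon>1}" using eps by (simp add: \<epsilon>\<delta>_def)
    ultimately show False using ex1 r z0 ne by blast
  qed
  show ?thesis
  proof (intro exI conjI)
    show "0 < \<epsilon>\<delta>" "\<epsilon>\<delta> \<le> \<epsilon>1"
      using \<epsilon>1 B(1) \<epsilon>4(1) by (simp_all add: \<epsilon>\<delta>_def)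
  qed (use main in blast)
qed

end
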